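(* There is a quantum algorithm (tester) with the following guarantee. Let $n$ be a positive integer, let $\epsilon \in (0,1)$, and let $p=(p_i)_{i=1}^n$ and $q=(q_i)_{i=1}^n$ be probability distributions on $[n]$ given by purified quantum query-access oracles $U_p$ and $U_q$. Under the promise that either $p=q$ or $\|p-q\|_2 \ge \epsilon$, the algorithm decides which of the two is the case with probability at least $\frac{2}{3}$, using $O\!\left(\frac{1}{\epsilon}\right)$ calls to $U_p$, $U_q$, their inverses or their controlled versions.
   Context: Notation: $[n]=\{1,\dots,n\}$, and $\|p-q\|_2 := \left(\sum_{i=1}^n |p_i-q_i|^2\right)^{1/2}$. Purified quantum query-access: a classical distribution $(p_i)_{i=1}^n$ on $[n]$ has purified quantum query-access if one has access to a unitary oracle $U_p$ (and to its inverse and controlled versions) on a bipartite system $A\otimes B$ acting as $$U_p |0\rangle_A |0\rangle_B = \sum_{i=1}^n \sqrt{p_i}\, |\phi_i\rangle_A |i\rangle_B,$$ where $\langle \phi_i|\phi_j\rangle=\delta_{ij}$. Here $A$ and $B$ are finite-dimensional Hilbert spaces, $B=\mathbb{C}^n=\mathrm{span}\{|1\rangle,\dots,|n\rangle\}$ with orthonormal basis $|1\rangle,\dots,|n\rangle$, and $|0\rangle_A$, $|0\rangle_B$ denote fixed reference unit vectors. The oracle $U_q$ for $q$ is of the same form (with its own orthonormal vectors in place of the $|\phi_i\rangle$), on the same systems $A$, $B$ with the same reference vectors. A quantum algorithm in this model knows the parameters $n,\epsilon$ but has access to $p$ and $q$ only through the oracles. It applies calls to the oracles interleaved with oracle-independent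 unitaries and measurements, and outputs a decision. The complexity is the number of oracle calls. The constant in $O(\cdot)$ is universal. *)

theory Defs
  imports "HOL-Analysis.L2_Norm" "Jordan_Normal_Form.Schur_Decomposition"
begin

subsection \<open>Linear algebra\<close>

definition tensor_vec :: "complex vec \<Rightarrow> complex vec \<Rightarrow> complex vec" (infixr "\<otimes>\<^sub>v" 72) where
  "v \<otimes>\<^sub>v w = vec (dim_vec v * dim_vec w)
     (\<lambda>i. v $ (i div dim_vec w) * w $ (i mod dim_vec w))"

text \<open>The Kronecker product.\<close>

definition tensor_mat :: "complex mat \<Rightarrow> complex mat \<Rightarrow> complex mat" (infixr "\<otimes>\<^sub>m" 72) where
  "M \<otimes>\<^sub>m N = mat (dim_row M * dim_row N) (dim_col M * dim_col N)
     (\<lambda>(i, j). M $$ (i div dim_row N, j div dim_col N) * N $$ (i mod dim_row N, j mod dim_col N))"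

definition unitary_mat :: "nat \<Rightarrow> complex mat \<Rightarrow> bool" where
  "unitary_mat d U \<longleftrightarrow>
     U \<in> carrier_mat d d \<and> mat_adjoint U * U = 1\<^sub>m d \<and> U * mat_adjoint U = 1\<^sub>m d"

definition unit_vector :: "nat \<Rightarrow> complex vec \<Rightarrow> bool" where
  "unit_vector d v \<longleftrightarrow> v \<in> carrier_vec d \<and> v \<bullet>c v = 1"

definition projector :: "nat \<Rightarrow> complex mat \<Rightarrow> bool" where
  "projector d P \<longleftrightarrow> P \<in> carrier_mat d d \<and> P * P = P \<and> mat_adjoint P = P"

definition projective_measurement :: "nat \<Rightarrow> complex mat list \<Rightarrow> bool" where
  "projective_measurement d Ps \<longleftrightarrow>
     (\<forall>P \<in> set Ps. projector d P) \<and> foldr (+) Ps (0\<^sub>m d d) = 1\<^sub>m d"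


subsection \<open>Purified quantum query-access\<close>

definition distribution :: "nat \<Rightarrow> (nat \<Rightarrow> real) \<Rightarrow> bool" where
  "distribution n p \<longleftrightarrow> (\<forall>i \<in> {1..n}. 0 \<le> p i) \<and> (\<Sum>i \<in> {1..n}. p i) = 1"

text \<open>The basis vector \<open>|i\<rangle>\<close> of the system \<open>B\<close>, for \<open>i\<close> in \<open>{1..n}\<close>.\<close>

definition ket :: "nat \<Rightarrow> nat \<Rightarrow> complex vec" where
  "ket n i = unit_vec n (i - 1)"

text \<open>Here \<open>a\<close> is the dimension of \<open>A\<close>, and \<open>rA\<close>, \<open>rB\<close> are the reference vectors
  \<open>|0\<rangle>\<close> of \<open>A\<close> and of \<open>B\<close>.\<close>

definition purified_access ::
  "nat \<Rightarrow> nat \<Rightarrow> complex vec \<Rightarrow> complex vec \<Rightarrow> (nat \<Rightarrow> real) \<Rightarrow> complex mat \<Rightarrow> bool" where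
  "purified_access n a rA rB p U \<longleftrightarrow>
     unitary_mat (a * n) U \<and>
     (\<exists>\<phi>. (\<forall>i \<in> {1..n}. \<phi> i \<in> carrier_vec a) \<and>
          (\<forall>i \<in> {1..n}. \<forall>j \<in> {1..n}. \<phi> i \<bullet>c \<phi> j = (if i = j then 1 else 0)) \<and>
          U *\<^sub>v (rA \<otimes>\<^sub>v rB) =
            finsum_vec TYPE(complex) (a * n)
              (\<lambda>i. complex_of_real (sqrt (p i)) \<cdot>\<^sub>v (\<phi> i \<otimes>\<^sub>v ket n i)) {1..n})"


subsection \<open>Quantum query algorithms with two oracles\<close>

datatype source = Source_P | Source_Q
datatype direction = Forward | Inverse
datatype control = Uncontrolled | Controlled
datatype decision = Equal | Far

text \<open>An adaptive algorithm is a decision tree.  After \<open>Measure Ps K\<close> with outcome \<open>k\<close>, it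
  continues with \<open>K k\<close>; the values of \<open>K\<close> beyond the length of \<open>Ps\<close> are irrelevant.\<close>

datatype query_alg =
    Output decision
  | Gate "complex mat" query_alg
  | Query source direction control query_alg
  | Measure "complex mat list" "nat \<Rightarrow> query_alg"

primrec well_formed :: "nat \<Rightarrow> query_alg \<Rightarrow> bool" where
  "well_formed d (Output r) \<longleftrightarrow> True"
| "well_formed d (Gate V T) \<longleftrightarrow> unitary_mat d V \<and> well_formed d T"
| "well_formed d (Query s e c T) \<longleftrightarrow> well_formed d T"
| "well_formed d (Measure Ps K) \<longleftrightarrow>
     projective_measurement d Ps \<and> (\<forall>k < length Ps. well_formed d (K k))"

text \<open>The number of oracle calls on the worst branch.\<close>

primrec query_count :: "query_alg \<Rightarrow> nat" where
  "query_count (Output r) = 0"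
| "query_count (Gate V T) = query_count T"
| "query_count (Query s e c T) = Suc (query_count T)"
| "query_count (Measure Ps K) = Max ((\<lambda>k. query_count (K k)) ` {..<length Ps})"

text \<open>The algorithm acts on (control qubit) \<open>\<otimes>\<close> (system \<open>A \<otimes> B\<close>, of dimension \<open>m\<close>)
  \<open>\<otimes>\<close> (workspace of dimension \<open>w\<close>).  As the control qubit is the leftmost factor, the
  controlled version of \<open>U\<close> is block diagonal with blocks \<open>1\<close> (control \<open>|0\<rangle>\<close>) and \<open>U\<close>
  (control \<open>|1\<rangle>\<close>).\<close>

definition total_dim :: "nat \<Rightarrow> nat \<Rightarrow> nat" where
  "total_dim m w = (2 * m) * w"

fun directed :: "direction \<Rightarrow> complex mat \<Rightarrow> complex mat" where
  "directed Forward U = U"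
| "directed Inverse U = mat_adjoint U"

fun with_control :: "control \<Rightarrow> nat \<Rightarrow> complex mat \<Rightarrow> complex mat" where
  "with_control Uncontrolled m U = 1\<^sub>m 2 \<otimes>\<^sub>m U"
| "with_control Controlled m U = four_block_mat (1\<^sub>m m) (0\<^sub>m m m) (0\<^sub>m m m) U"

fun chosen :: "source \<Rightarrow> complex mat \<Rightarrow> complex mat \<Rightarrow> complex mat" where
  "chosen Source_P Up Uq = Up"
| "chosen Source_Q Up Uq = Uq"

definition query_op ::
  "nat \<Rightarrow> nat \<Rightarrow> complex mat \<Rightarrow> complex mat \<Rightarrow> source \<Rightarrow> direction \<Rightarrow> control \<Rightarrow> complex mat" where
  "query_op m w Up Uq s e c = with_control c m (directed e (chosen s Up Uq)) \<otimes>\<^sub>m 1\<^sub>m w"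

text \<open>States are not renormalised after a measurement, so that the squared norm of the state
  reached in a leaf is the probability of reaching that leaf.\<close>

primrec prob_output_from ::
  "nat \<Rightarrow> nat \<Rightarrow> complex mat \<Rightarrow> complex mat \<Rightarrow> decision \<Rightarrow> query_alg \<Rightarrow> complex vec \<Rightarrow> real" where
  "prob_output_from m w Up Uq r (Output r') v = (if r' = r then Re (v \<bullet>c v) else 0)"
| "prob_output_from m w Up Uq r (Gate V T) v = prob_output_from m w Up Uq r T (V *\<^sub>v v)"
| "prob_output_from m w Up Uq r (Query s e c T) v =
     prob_output_from m w Up Uq r T (query_op m w Up Uq s e c *\<^sub>v v)"
| "prob_output_from m w Up Uq r (Measure Ps K) v =
     (\<Sum>k < length Ps. prob_output_from m w Up Uq r (K k) ((Ps ! k) *\<^sub>v v))"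

definition initial_state :: "complex vec \<Rightarrow> complex vec \<Rightarrow> nat \<Rightarrow> complex vec" where
  "initial_state rA rB w = (unit_vec 2 0 \<otimes>\<^sub>v (rA \<otimes>\<^sub>v rB)) \<otimes>\<^sub>v unit_vec w 0"

definition prob_output ::
  "complex vec \<Rightarrow> complex vec \<Rightarrow> nat \<Rightarrow> complex mat \<Rightarrow> complex mat \<Rightarrow> decision \<Rightarrow> query_alg \<Rightarrow> real"
  where
  "prob_output rA rB w Up Uq r T =
     prob_output_from (dim_vec rA * dim_vec rB) w Up Uq r T (initial_state rA rB w)"

end

theory Submission
  imports Defs
begin

text \<open>Write \<open>|0\<rangle>\<close> for the reference state of \<open>A \<otimes> B\<close>. Copying \<open>B\<close> between \<open>U\<^sub>p\<close> and
  its inverse maps \<open>|0\<rangle>|0\<rangle>\<close> to a state whose \<open>|0\<rangle>\<close>-component is the sum of the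
  \<open>p\<^sub>i |0\<rangle>|i\<rangle>\<close>: probabilities have become amplitudes. With a workspace qubit in the state
  \<open>(|0\<rangle> - |1\<rangle>)/\<surd>2\<close> that selects between \<open>p\<close> and \<open>q\<close>, four queries thus map a
  fixed state \<open>s\<close> to a state whose component in a known subspace has squared norm
  \<open>t = \<parallel>p - q\<parallel>\<^sup>2 / 4\<close>. If \<open>t = 0\<close>, then the Grover iterate fixes \<open>s\<close> up to
  sign; otherwise it is a rotation by an angle of order \<open>\<surd>t\<close>. The tester runs \<open>k\<close> iterations
  for all \<open>k < K\<close> in superposition, and measures whether the superposition is intact. The
  amplitude for this is the average of the overlaps of \<open>s\<close> with its \<open>k\<close>-th iterate; this is
  \<open>1\<close> if \<open>p = q\<close>, and the sum of the overlaps is at most \<open>1 + 1 / (2 \<surd>t)\<close> otherwise. Hence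
  \<open>K \<ge> 4 / \<epsilon>\<close> suffices. The selection by a workspace qubit needs no controlled queries, as
  without the copying the query and its inverse cancel.\<close>

section \<open>Index arithmetic for tensor products\<close>

lemma sum_div_mod:
  fixes f :: "nat \<Rightarrow> nat \<Rightarrow> 'a::comm_monoid_add"
  shows "(\<Sum>i<m * n. f (i div n) (i mod n)) = (\<Sum>i<m. \<Sum>j<n. f i j)"
proof -
  have "(\<Sum>i<m * n. f (i div n) (i mod n))
      = (\<Sum>i<m. \<Sum>x\<in>{i * n..<i * n + n}. f (x div n) (x mod n))"
    by (rule sum.nat_group[symmetric])
  also have "\<dots> = (\<Sum>i<m. \<Sum>j<n. f i j)"
  proof (rule sum.cong[OF refl])
    fix i
    have "(\<Sum>x\<in>{0 + i * n..<n + i * n}. f (x div n) (x mod n))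
        = (\<Sum>j\<in>{0..<n}. f ((j + i * n) div n) ((j + i * n) mod n))"
      by (rule sum.shift_bounds_nat_ivl)
    also have "\<dots> = (\<Sum>j<n. f i j)"
      by (auto simp: atLeast0LessThan intro!: sum.cong)
    finally show "(\<Sum>x\<in>{i * n..<i * n + n}. f (x div n) (x mod n)) = (\<Sum>j<n. f i j)"
      by (simp add: add.commute)
  qed
  finally show ?thesis .
qed

lemma div_less_prod: "(i::nat) < m * n \<Longrightarrow> i div n < m"
  by (simp add: less_mult_imp_div_less)

lemma mod_less_prod: "(i::nat) < m * n \<Longrightarrow> i mod n < n"
  by (cases "n = 0") auto

section \<open>Inner products and adjoints\<close>

lemma cinner_sum: "v \<bullet>c w = (\<Sum>i<dim_vec w. v $ i * cnj (w $ i))" for v w :: "complex vec"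
  by (auto simp: scalar_prod_def atLeast0LessThan intro!: sum.cong)

lemma mult_mat_vec_index:
  "A \<in> carrier_mat m n \<Longrightarrow> v \<in> carrier_vec n \<Longrightarrow> i < m \<Longrightarrow>
    (A *\<^sub>v v) $ i = (\<Sum>j<n. A $$ (i, j) * v $ j)"
  by (auto simp: scalar_prod_def atLeast0LessThan intro!: sum.cong)

lemma mult_mat_index:
  "A \<in> carrier_mat m n \<Longrightarrow> B \<in> carrier_mat n k \<Longrightarrow> i < m \<Longrightarrow> j < k \<Longrightarrow>
    (A * B) $$ (i, j) = (\<Sum>l<n. A $$ (i, l) * B $$ (l, j))"
  by (auto simp: scalar_prod_def atLeast0LessThan intro!: sum.cong)

lemma cinner_cnj: "v \<in> carrier_vec N \<Longrightarrow> w \<in> carrier_vec N \<Longrightarrow> w \<bullet>c v = cnj (v \<bullet>c w)"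
  for v w :: "complex vec"
  by (auto simp: cinner_sum mult.commute)

lemma cinner_add_left:
  "u \<in> carrier_vec N \<Longrightarrow> v \<in> carrier_vec N \<Longrightarrow> w \<in> carrier_vec N \<Longrightarrow>
    (u + v) \<bullet>c w = u \<bullet>c w + v \<bullet>c w" for u v w :: "complex vec"
  by (auto simp: cinner_sum sum.distrib algebra_simps)

lemma cinner_minus_left:
  "u \<in> carrier_vec N \<Longrightarrow> v \<in> carrier_vec N \<Longrightarrow> w \<in> carrier_vec N \<Longrightarrow>
    (u - v) \<bullet>c w = u \<bullet>c w - v \<bullet>c w" for u v w :: "complex vec"
  by (auto simp: cinner_sum sum_subtractf algebra_simps)

lemma cinner_smult_left:
  "v \<in> carrier_vec N \<Longrightarrow> w \<in> carrier_vec N \<Longrightarrow> (c \<cdot>\<^sub>v v) \<bullet>c w = c * (v \<bullet>c w)"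
  for v w :: "complex vec"
  by (auto simp: cinner_sum sum_distrib_left algebra_simps)

lemma cinner_add_right:
  "u \<in> carrier_vec N \<Longrightarrow> v \<in> carrier_vec N \<Longrightarrow> w \<in> carrier_vec N \<Longrightarrow>
    w \<bullet>c (u + v) = w \<bullet>c u + w \<bullet>c v" for u v w :: "complex vec"
  by (auto simp: cinner_sum sum.distrib algebra_simps)

lemma cinner_minus_right:
  "u \<in> carrier_vec N \<Longrightarrow> v \<in> carrier_vec N \<Longrightarrow> w \<in> carrier_vec N \<Longrightarrow>
    w \<bullet>c (u - v) = w \<bullet>c u - w \<bullet>c v" for u v w :: "complex vec"
  by (auto simp: cinner_sum sum_subtractf algebra_simps)

lemma cinner_smult_right:
  "v \<in> carrier_vec N \<Longrightarrow> w \<in> carrier_vec N \<Longrightarrow> v \<bullet>c (c \<cdot>\<^sub>v w) = cnj c * (v \<bullet>c w)"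
  for v w :: "complex vec"
  by (auto simp: cinner_sum sum_distrib_left algebra_simps)

lemmas cinner_linear = cinner_add_left cinner_minus_left cinner_smult_left
  cinner_add_right cinner_minus_right cinner_smult_right

lemma cinner_self_real: "v \<in> carrier_vec N \<Longrightarrow> v \<bullet>c v = complex_of_real (\<Sum>i<N. (cmod (v $ i))\<^sup>2)"
  for v :: "complex vec"
  unfolding cinner_sum of_real_sum
  by (rule sum.cong) (simp_all only: carrier_vecD complex_norm_square)

lemma cinner_self_eq_0: "v \<in> carrier_vec N \<Longrightarrow> v \<bullet>c v = 0 \<Longrightarrow> v = 0\<^sub>v N" for v :: "complex vec"
  using conjugate_square_eq_0_vec by blast

lemma adjoint_index:
  "A \<in> carrier_mat m n \<Longrightarrow> i < n \<Longrightarrow> j < m \<Longrightarrow> mat_adjoint A $$ (i, j) = cnj (A $$ (j, i))"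
  for A :: "complex mat"
  unfolding mat_adjoint_def by (auto simp: mat_of_rows_def cols_def)

lemma adjoint_carrier [simp]: "A \<in> carrier_mat m n \<Longrightarrow> mat_adjoint A \<in> carrier_mat n m"
  for A :: "complex mat"
  unfolding mat_adjoint_def by (auto simp: mat_of_rows_def)

lemma adjoint_dim [simp]:
  "dim_row (mat_adjoint A) = dim_col A" "dim_col (mat_adjoint A) = dim_row A" for A :: "complex mat"
  unfolding mat_adjoint_def by (auto simp: mat_of_rows_def)

lemma adjoint_adjoint: "A \<in> carrier_mat m n \<Longrightarrow> mat_adjoint (mat_adjoint A) = A"
  for A :: "complex mat"
  using adjoint_carrier[of A m n] adjoint_carrier[of "mat_adjoint A" n m]
  by (intro eq_matI) (auto simp: adjoint_index[of A m n] adjoint_index[of "mat_adjoint A" n m])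

lemma cinner_adjoint:
  fixes A :: "complex mat"
  assumes "A \<in> carrier_mat m n" "v \<in> carrier_vec n" "w \<in> carrier_vec m"
  shows "(A *\<^sub>v v) \<bullet>c w = v \<bullet>c (mat_adjoint A *\<^sub>v w)"
proof -
  have "(A *\<^sub>v v) \<bullet>c w = (\<Sum>i<m. \<Sum>j<n. A $$ (i, j) * v $ j * cnj (w $ i))"
    using assms by (simp add: cinner_sum mult_mat_vec_index[OF assms(1,2)] sum_distrib_right
        del: index_mult_mat_vec)
  also have "\<dots> = (\<Sum>j<n. \<Sum>i<m. A $$ (i, j) * v $ j * cnj (w $ i))"
    by (rule sum.swap)
  also have "\<dots> = v \<bullet>c (mat_adjoint A *\<^sub>v w)"
  proof -
    have "dim_vec (mat_adjoint A *\<^sub>v w) = n"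
      using assms(1) by simp
    then show ?thesis
      using assms by (simp add: cinner_sum mult_mat_vec_index[OF adjoint_carrier[OF assms(1)] assms(3)]
          adjoint_index[OF assms(1)] sum_distrib_left mult_ac del: index_mult_mat_vec)
  qed
  finally show ?thesis .
qed

lemma unitary_carrier: "unitary_mat d U \<Longrightarrow> U \<in> carrier_mat d d"
  by (simp add: unitary_mat_def)

lemma unitary_adjoint: "unitary_mat d U \<Longrightarrow> unitary_mat d (mat_adjoint U)"
  by (auto simp: unitary_mat_def adjoint_adjoint)

lemma unitary_adjoint_mult_vec:
  "unitary_mat d U \<Longrightarrow> v \<in> carrier_vec d \<Longrightarrow> mat_adjoint U *\<^sub>v (U *\<^sub>v v) = v"
  by (subst assoc_mult_mat_vec[symmetric, of _ d d _ d]) (auto simp: unitary_mat_def)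

lemma unitary_mult_adjoint_vec:
  "unitary_mat d U \<Longrightarrow> v \<in> carrier_vec d \<Longrightarrow> U *\<^sub>v (mat_adjoint U *\<^sub>v v) = v"
  by (subst assoc_mult_mat_vec[symmetric, of _ d d _ d]) (auto simp: unitary_mat_def)

lemma unitary_cinner:
  assumes "unitary_mat d U" "v \<in> carrier_vec d" "w \<in> carrier_vec d"
  shows "(U *\<^sub>v v) \<bullet>c (U *\<^sub>v w) = v \<bullet>c w"
proof -
  have U: "U \<in> carrier_mat d d"
    by (rule unitary_carrier[OF assms(1)])
  then have "U *\<^sub>v w \<in> carrier_vec d"
    using assms by simp
  then show ?thesis
    using assms cinner_adjoint[OF U] by (simp add: unitary_adjoint_mult_vec)
qed

text \<open>A Hermitian matrix whose square is one has itself as adjoint and as inverse. This covers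
  the reflections and the permutation gates, whose entries are explicit; hence the entrywise
  hypothesis.\<close>

lemma unitaryI_involution:
  assumes "U \<in> carrier_mat d d" "U * U = 1\<^sub>m d"
    "\<And>i j. i < d \<Longrightarrow> j < d \<Longrightarrow> cnj (U $$ (j, i)) = U $$ (i, j)"
  shows "unitary_mat d U" "mat_adjoint U = U"
proof -
  show "mat_adjoint U = U"
    using assms(1,3) adjoint_carrier[OF assms(1)]
    by (intro eq_matI) (auto simp: adjoint_index[OF assms(1)])
  then show "unitary_mat d U"
    using assms by (simp add: unitary_mat_def)
qed

lemma unitary_mult:
  assumes "unitary_mat d U" "unitary_mat d V"
  shows "unitary_mat d (U * V)" "mat_adjoint (U * V) = mat_adjoint V * mat_adjoint U"
proof -
  have c: "U \<in> carrier_mat d d" "V \<in> carrier_mat d d" "U * V \<in> carrier_mat d d"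
    "mat_adjoint U \<in> carrier_mat d d" "mat_adjoint V \<in> carrier_mat d d"
    using assms[THEN unitary_carrier] assms[THEN unitary_adjoint, THEN unitary_carrier] by auto
  show adj: "mat_adjoint (U * V) = mat_adjoint V * mat_adjoint U"
  proof (rule eq_matI)
    fix i j assume "i < dim_row (mat_adjoint V * mat_adjoint U)"
      "j < dim_col (mat_adjoint V * mat_adjoint U)"
    then have ij: "i < d" "j < d"
      using c by auto
    then show "mat_adjoint (U * V) $$ (i, j) = (mat_adjoint V * mat_adjoint U) $$ (i, j)"
      using c(1,2) by (simp add: adjoint_index[OF c(3)] mult_mat_index[OF c(1,2)]
          mult_mat_index[OF c(5,4)] adjoint_index[of _ d d] mult.commute del: index_mult_mat)
  qed (use c adjoint_carrier[OF c(3)] in auto)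
  have "mat_adjoint V * mat_adjoint U * (U * V) = mat_adjoint V * (mat_adjoint U * (U * V))"
    using c by (intro assoc_mult_mat) auto
  also have "mat_adjoint U * (U * V) = (mat_adjoint U * U) * V"
    using c by (intro assoc_mult_mat[symmetric]) auto
  also have "mat_adjoint U * U * V = V"
    using assms c by (simp only: unitary_mat_def left_mult_one_mat)
  finally have 1: "mat_adjoint V * mat_adjoint U * (U * V) = 1\<^sub>m d"
    using assms by (simp only: unitary_mat_def)
  have "U * V * (mat_adjoint V * mat_adjoint U) = U * (V * (mat_adjoint V * mat_adjoint U))"
    using c by (intro assoc_mult_mat) auto
  also have "V * (mat_adjoint V * mat_adjoint U) = (V * mat_adjoint V) * mat_adjoint U"
    using c by (intro assoc_mult_mat[symmetric]) auto
  also have "V * mat_adjoint V * mat_adjoint U = mat_adjoint U"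
    using assms c by (simp only: unitary_mat_def left_mult_one_mat)
  finally have 2: "U * V * (mat_adjoint V * mat_adjoint U) = 1\<^sub>m d"
    using assms by (simp only: unitary_mat_def)
  show "unitary_mat d (U * V)"
    unfolding unitary_mat_def adj using 1 2 c by blast
qed

section \<open>Tensor products\<close>

lemma tensor_vec_carrier [simp]:
  "v \<in> carrier_vec m \<Longrightarrow> w \<in> carrier_vec n \<Longrightarrow> v \<otimes>\<^sub>v w \<in> carrier_vec (m * n)"
  by (auto simp: tensor_vec_def)

lemma tensor_mat_carrier [simp]:
  "A \<in> carrier_mat m n \<Longrightarrow> B \<in> carrier_mat k l \<Longrightarrow> A \<otimes>\<^sub>m B \<in> carrier_mat (m * k) (n * l)"
  by (auto simp: tensor_mat_def)

lemma tensor_mat_index: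
  "A \<in> carrier_mat m n \<Longrightarrow> B \<in> carrier_mat k l \<Longrightarrow> i < m * k \<Longrightarrow> j < n * l \<Longrightarrow>
    (A \<otimes>\<^sub>m B) $$ (i, j) = A $$ (i div k, j div l) * B $$ (i mod k, j mod l)"
  by (auto simp: tensor_mat_def)

text \<open>The sum over the joint index factors into one sum per tensor factor.\<close>

lemma tensor_mat_mult_vec:
  assumes A: "A \<in> carrier_mat m m'" and B: "B \<in> carrier_mat n n'"
    and v: "v \<in> carrier_vec m'" and w: "w \<in> carrier_vec n'"
  shows "(A \<otimes>\<^sub>m B) *\<^sub>v (v \<otimes>\<^sub>v w) = (A *\<^sub>v v) \<otimes>\<^sub>v (B *\<^sub>v w)"
proof (rule eq_vecI)
  fix i assume "i < dim_vec ((A *\<^sub>v v) \<otimes>\<^sub>v (B *\<^sub>v w))"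
  then have i: "i < m * n"
    using A B by (simp add: tensor_vec_def)
  have "((A \<otimes>\<^sub>m B) *\<^sub>v (v \<otimes>\<^sub>v w)) $ i
      = (\<Sum>j<m' * n'. (A $$ (i div n, j div n') * v $ (j div n')) *
          (B $$ (i mod n, j mod n') * w $ (j mod n')))"
    using assms i by (subst mult_mat_vec_index[of _ "m * n" "m' * n'"])
      (auto simp: tensor_mat_def tensor_vec_def intro!: sum.cong)
  also have "\<dots> = (\<Sum>j<m'. A $$ (i div n, j) * v $ j) * (\<Sum>k<n'. B $$ (i mod n, k) * w $ k)"
    by (simp add: sum_div_mod[where f = "\<lambda>x y. A $$ (i div n, x) * v $ x * (B $$ (i mod n, y) * w $ y)"] sum_product)
  also have "\<dots> = ((A *\<^sub>v v) \<otimes>\<^sub>v (B *\<^sub>v w)) $ i"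
    using assms i by (simp add: tensor_vec_def mult_mat_vec_index[OF A v] mult_mat_vec_index[OF B w]
        div_less_prod mod_less_prod del: index_mult_mat_vec)
  finally show "((A \<otimes>\<^sub>m B) *\<^sub>v (v \<otimes>\<^sub>v w)) $ i = ((A *\<^sub>v v) \<otimes>\<^sub>v (B *\<^sub>v w)) $ i" .
qed (use assms in \<open>simp_all add: tensor_mat_def tensor_vec_def\<close>)

lemma tensor_mat_mult:
  assumes A: "A \<in> carrier_mat m m'" and B: "B \<in> carrier_mat n n'"
    and C: "C \<in> carrier_mat m' k" and D: "D \<in> carrier_mat n' l"
  shows "(A \<otimes>\<^sub>m B) * (C \<otimes>\<^sub>m D) = (A * C) \<otimes>\<^sub>m (B * D)"
proof (rule eq_matI)
  fix i j assume "i < dim_row ((A * C) \<otimes>\<^sub>m (B * D))" "j < dim_col ((A * C) \<otimes>\<^sub>m (B * D))"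
  then have i: "i < m * n" and j: "j < k * l"
    using assms by (auto simp: tensor_mat_def)
  have "((A \<otimes>\<^sub>m B) * (C \<otimes>\<^sub>m D)) $$ (i, j)
      = (\<Sum>x<m' * n'. (A $$ (i div n, x div n') * C $$ (x div n', j div l)) *
          (B $$ (i mod n, x mod n') * D $$ (x mod n', j mod l)))"
    using assms i j by (subst mult_mat_index[of _ "m * n" "m' * n'" _ "k * l"])
      (auto simp: tensor_mat_def intro!: sum.cong)
  also have "\<dots> = (\<Sum>x<m'. A $$ (i div n, x) * C $$ (x, j div l)) *
      (\<Sum>y<n'. B $$ (i mod n, y) * D $$ (y, j mod l))"
    by (simp add: sum_div_mod[where f = "\<lambda>x y. A $$ (i div n, x) * C $$ (x, j div l) *
        (B $$ (i mod n, y) * D $$ (y, j mod l))"] sum_product)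
  also have "\<dots> = ((A * C) \<otimes>\<^sub>m (B * D)) $$ (i, j)"
    using i j by (simp add: tensor_mat_index[OF mult_carrier_mat[OF A C] mult_carrier_mat[OF B D]]
        mult_mat_index[OF A C] mult_mat_index[OF B D]
        div_less_prod mod_less_prod del: index_mult_mat)
  finally show "((A \<otimes>\<^sub>m B) * (C \<otimes>\<^sub>m D)) $$ (i, j) = ((A * C) \<otimes>\<^sub>m (B * D)) $$ (i, j)" .
qed (use assms in \<open>simp_all add: tensor_mat_def\<close>)

lemma tensor_mat_one: "1\<^sub>m m \<otimes>\<^sub>m 1\<^sub>m n = 1\<^sub>m (m * n)"
proof (rule eq_matI)
  fix i j assume "i < dim_row (1\<^sub>m (m * n) :: complex mat)" "j < dim_col (1\<^sub>m (m * n) :: complex mat)"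
  then have ij: "i < m * n" "j < m * n"
    by auto
  have "i div n = j div n \<and> i mod n = j mod n \<longleftrightarrow> i = j"
    by (metis div_mult_mod_eq)
  then show "(1\<^sub>m m \<otimes>\<^sub>m 1\<^sub>m n) $$ (i, j) = 1\<^sub>m (m * n) $$ (i, j)"
    using ij by (auto simp: tensor_mat_def div_less_prod mod_less_prod)
qed (auto simp: tensor_mat_def)

lemma tensor_mat_adjoint:
  assumes A: "A \<in> carrier_mat m m'" and B: "B \<in> carrier_mat n n'"
  shows "mat_adjoint (A \<otimes>\<^sub>m B) = mat_adjoint A \<otimes>\<^sub>m mat_adjoint B"
proof -
  note c = adjoint_carrier[OF A] adjoint_carrier[OF B] adjoint_carrier[OF tensor_mat_carrier[OF A B]]
  show ?thesis
  proof (rule eq_matI)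
    fix i j assume "i < dim_row (mat_adjoint A \<otimes>\<^sub>m mat_adjoint B)"
      "j < dim_col (mat_adjoint A \<otimes>\<^sub>m mat_adjoint B)"
    then have i: "i < m' * n'" and j: "j < m * n"
      using c by (auto simp: tensor_mat_def)
    then show "mat_adjoint (A \<otimes>\<^sub>m B) $$ (i, j) = (mat_adjoint A \<otimes>\<^sub>m mat_adjoint B) $$ (i, j)"
      by (simp add: adjoint_index[OF tensor_mat_carrier[OF A B]] tensor_mat_index[OF A B]
          tensor_mat_index[OF c(1,2)] adjoint_index[OF A] adjoint_index[OF B]
          div_less_prod mod_less_prod)
  qed (use c in \<open>auto simp: tensor_mat_def\<close>)
qed

lemma one_mat_unitary: "unitary_mat n (1\<^sub>m n)"
  by (rule unitaryI_involution) auto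

lemma tensor_mat_unitary:
  assumes "unitary_mat m U" "unitary_mat n V"
  shows "unitary_mat (m * n) (U \<otimes>\<^sub>m V)"
proof -
  note c = unitary_carrier[OF assms(1)] unitary_carrier[OF assms(2)]
  show ?thesis
    using assms c by (auto simp: unitary_mat_def tensor_mat_adjoint[OF c] tensor_mat_one
        tensor_mat_mult[OF c adjoint_carrier[OF c(1)] adjoint_carrier[OF c(2)]]
        tensor_mat_mult[OF adjoint_carrier[OF c(1)] adjoint_carrier[OF c(2)] c])
qed

lemma cinner_tensor:
  assumes "v \<in> carrier_vec m" "v' \<in> carrier_vec m" "w \<in> carrier_vec n" "w' \<in> carrier_vec n"
  shows "(v \<otimes>\<^sub>v w) \<bullet>c (v' \<otimes>\<^sub>v w') = (v \<bullet>c v') * (w \<bullet>c w')"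
proof -
  have "(v \<otimes>\<^sub>v w) \<bullet>c (v' \<otimes>\<^sub>v w')
      = (\<Sum>i<m * n. (v $ (i div n) * cnj (v' $ (i div n))) * (w $ (i mod n) * cnj (w' $ (i mod n))))"
    using assms by (auto simp: cinner_sum tensor_vec_def mult_ac intro!: sum.cong)
  then show ?thesis
    using assms by (simp add: sum_div_mod[where f = "\<lambda>x y. v $ x * cnj (v' $ x) * (w $ y * cnj (w' $ y))"]
        cinner_sum sum_product)
qed

section \<open>Linear combinations and reflections\<close>

text \<open>Entrywise sums give dimension \<open>N\<close> for every index set, the empty one
  included, and reduce linearity of matrices and inner products to exchanges of sums.\<close>

definition comb :: "nat \<Rightarrow> 'i set \<Rightarrow> ('i \<Rightarrow> complex) \<Rightarrow> ('i \<Rightarrow> complex vec) \<Rightarrow> complex vec" where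
  "comb N I c f = vec N (\<lambda>x. \<Sum>i\<in>I. c i * f i $ x)"

lemma comb_carrier [simp]: "comb N I c f \<in> carrier_vec N"
  by (simp add: comb_def)

lemma comb_index: "x < N \<Longrightarrow> comb N I c f $ x = (\<Sum>i\<in>I. c i * f i $ x)"
  by (simp add: comb_def)

lemma mult_comb:
  assumes "A \<in> carrier_mat M N" "\<And>i. i \<in> I \<Longrightarrow> f i \<in> carrier_vec N"
  shows "A *\<^sub>v comb N I c f = comb M I c (\<lambda>i. A *\<^sub>v f i)"
proof (rule eq_vecI)
  fix x assume "x < dim_vec (comb M I c (\<lambda>i. A *\<^sub>v f i))"
  then have x: "x < M"
    by (simp add: comb_def)
  then have "(A *\<^sub>v comb N I c f) $ x = (\<Sum>y<N. \<Sum>i\<in>I. A $$ (x, y) * (c i * f i $ y))"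
    using assms by (simp add: mult_mat_vec_index[OF assms(1) comb_carrier] comb_index sum_distrib_left
        del: index_mult_mat_vec)
  also have "\<dots> = (\<Sum>i\<in>I. \<Sum>y<N. A $$ (x, y) * (c i * f i $ y))"
    by (rule sum.swap)
  also have "\<dots> = comb M I c (\<lambda>i. A *\<^sub>v f i) $ x"
    using assms x by (simp add: comb_def mult_mat_vec_index[OF assms(1)] sum_distrib_left mult_ac
        del: index_mult_mat_vec)
  finally show "(A *\<^sub>v comb N I c f) $ x = comb M I c (\<lambda>i. A *\<^sub>v f i) $ x" .
qed (use assms in \<open>auto simp: comb_def\<close>)

lemma cinner_comb_left:
  assumes "\<And>i. i \<in> I \<Longrightarrow> f i \<in> carrier_vec N" "w \<in> carrier_vec N"
  shows "comb N I c f \<bullet>c w = (\<Sum>i\<in>I. c i * (f i \<bullet>c w))"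
proof -
  have "comb N I c f \<bullet>c w = (\<Sum>x<N. \<Sum>i\<in>I. c i * f i $ x * cnj (w $ x))"
    using assms by (simp add: cinner_sum comb_def sum_distrib_right)
  also have "\<dots> = (\<Sum>i\<in>I. \<Sum>x<N. c i * f i $ x * cnj (w $ x))"
    by (rule sum.swap)
  finally show ?thesis
    using assms by (simp add: cinner_sum sum_distrib_left mult_ac)
qed

lemma cinner_comb_right:
  assumes "\<And>i. i \<in> I \<Longrightarrow> f i \<in> carrier_vec N" "w \<in> carrier_vec N"
  shows "w \<bullet>c comb N I c f = (\<Sum>i\<in>I. cnj (c i) * (w \<bullet>c f i))"
proof -
  have "w \<bullet>c comb N I c f = cnj (comb N I c f \<bullet>c w)"
    using assms by (intro cinner_cnj) auto
  also have "\<dots> = (\<Sum>i\<in>I. cnj (c i) * cnj (f i \<bullet>c w))"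
    using assms by (subst cinner_comb_left) auto
  also have "\<dots> = (\<Sum>i\<in>I. cnj (c i) * (w \<bullet>c f i))"
    using assms by (intro sum.cong refl) (metis cinner_cnj)
  finally show ?thesis .
qed

definition orthonormal :: "nat \<Rightarrow> 'i set \<Rightarrow> ('i \<Rightarrow> complex vec) \<Rightarrow> bool" where
  "orthonormal N I f \<longleftrightarrow> finite I \<and> (\<forall>i\<in>I. f i \<in> carrier_vec N) \<and>
    (\<forall>i\<in>I. \<forall>j\<in>I. f i \<bullet>c f j = (if i = j then 1 else 0))"

lemma orthonormal_subset: "orthonormal N I f \<Longrightarrow> J \<subseteq> I \<Longrightarrow> orthonormal N J f"
  unfolding orthonormal_def by (meson finite_subset subsetD)

definition span_proj :: "nat \<Rightarrow> 'i set \<Rightarrow> ('i \<Rightarrow> complex vec) \<Rightarrow> complex mat" where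
  "span_proj N I f = mat N N (\<lambda>(x, y). \<Sum>i\<in>I. f i $ x * cnj (f i $ y))"

text \<open>Sign convention: for an orthonormal \<open>f\<close> this is -1 on the span and +1 on
  its orthogonal complement.\<close>

definition reflection :: "nat \<Rightarrow> 'i set \<Rightarrow> ('i \<Rightarrow> complex vec) \<Rightarrow> complex mat" where
  "reflection N I f = 1\<^sub>m N - 2 \<cdot>\<^sub>m span_proj N I f"

lemma span_proj_carrier [simp]: "span_proj N I f \<in> carrier_mat N N"
  by (simp add: span_proj_def)

lemma reflection_carrier [simp]: "reflection N I f \<in> carrier_mat N N"
  unfolding reflection_def by (intro minus_carrier_mat smult_carrier_mat span_proj_carrier)

lemma span_proj_index:
  "x < N \<Longrightarrow> y < N \<Longrightarrow> span_proj N I f $$ (x, y) = (\<Sum>i\<in>I. f i $ x * cnj (f i $ y))"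
  by (simp add: span_proj_def)

lemma span_proj_dim [simp]: "dim_row (span_proj N I f) = N" "dim_col (span_proj N I f) = N"
  by (simp_all add: span_proj_def)

text \<open>The product of the outer products number \<open>i\<close> and \<open>j\<close> carries
  the factor \<open>f j \<bullet>c f i\<close>, so orthonormality leaves only the diagonal
  terms.\<close>

lemma span_proj_idem:
  assumes "orthonormal N I f"
  shows "span_proj N I f * span_proj N I f = span_proj N I f"
proof (rule eq_matI)
  fix x y assume "x < dim_row (span_proj N I f)" "y < dim_col (span_proj N I f)"
  then have xy: "x < N" "y < N"
    by (auto simp: span_proj_def)
  have f: "finite I" "\<And>i. i \<in> I \<Longrightarrow> f i \<in> carrier_vec N"
    using assms by (auto simp: orthonormal_def)
  have "(span_proj N I f * span_proj N I f) $$ (x, y)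
      = (\<Sum>z<N. (\<Sum>i\<in>I. f i $ x * cnj (f i $ z)) * (\<Sum>j\<in>I. f j $ z * cnj (f j $ y)))"
    using xy by (simp add: mult_mat_index[OF span_proj_carrier span_proj_carrier] span_proj_index del: index_mult_mat)
  also have "\<dots> = (\<Sum>z<N. \<Sum>i\<in>I. \<Sum>j\<in>I. f i $ x * cnj (f j $ y) * (f j $ z * cnj (f i $ z)))"
    unfolding sum_product by (intro sum.cong refl) (simp add: mult_ac)
  also have "\<dots> = (\<Sum>i\<in>I. \<Sum>z<N. \<Sum>j\<in>I. f i $ x * cnj (f j $ y) * (f j $ z * cnj (f i $ z)))"
    by (rule sum.swap)
  also have "\<dots> = (\<Sum>i\<in>I. \<Sum>j\<in>I. \<Sum>z<N. f i $ x * cnj (f j $ y) * (f j $ z * cnj (f i $ z)))"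
    by (intro sum.cong refl) (rule sum.swap)
  also have "\<dots> = (\<Sum>i\<in>I. \<Sum>j\<in>I. f i $ x * cnj (f j $ y) * (f j \<bullet>c f i))"
    by (intro sum.cong refl) (simp add: cinner_sum carrier_vecD[OF f(2)] sum_distrib_left)
  also have "\<dots> = (\<Sum>i\<in>I. \<Sum>j\<in>I. if i = j then f i $ x * cnj (f i $ y) else 0)"
    using assms by (intro sum.cong refl) (auto simp: orthonormal_def)
  also have "\<dots> = span_proj N I f $$ (x, y)"
    using f xy by (simp add: span_proj_index)
  finally show "(span_proj N I f * span_proj N I f) $$ (x, y) = span_proj N I f $$ (x, y)" .
qed (auto simp: span_proj_def)

lemma span_proj_hermitian: "mat_adjoint (span_proj N I f) = span_proj N I f"
  by (rule eq_matI) (auto simp: adjoint_index[OF span_proj_carrier] span_proj_index mult_ac)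

lemma span_proj_projector: "orthonormal N I f \<Longrightarrow> projector N (span_proj N I f)"
  by (simp add: projector_def span_proj_idem span_proj_hermitian)

lemma projector_compl:
  assumes "projector N P"
  shows "projector N (1\<^sub>m N - P)"
proof -
  have P: "P \<in> carrier_mat N N" "P * P = P" "mat_adjoint P = P"
    using assms by (auto simp: projector_def)
  have Q: "1\<^sub>m N - P \<in> carrier_mat N N"
    by (rule minus_carrier_mat[OF P(1)])
  have "(1\<^sub>m N - P) * (1\<^sub>m N - P) = (1\<^sub>m N - P) - (1\<^sub>m N - P) * P"
    using P Q by (subst mult_minus_distrib_mat[of _ N N _ N]) auto
  also have "(1\<^sub>m N - P) * P = P - P * P"
    using P by (subst minus_mult_distrib_mat[of _ N N _ _ N]) auto
  also have "(1\<^sub>m N - P) - (P - P * P) = 1\<^sub>m N - P"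
    using P by (intro eq_matI) auto
  finally have "(1\<^sub>m N - P) * (1\<^sub>m N - P) = 1\<^sub>m N - P" .
  moreover have "mat_adjoint (1\<^sub>m N - P) = 1\<^sub>m N - P"
  proof (rule eq_matI)
    fix i j assume "i < dim_row (1\<^sub>m N - P)" "j < dim_col (1\<^sub>m N - P)"
    then have ij: "i < N" "j < N"
      using P by auto
    then have "cnj (P $$ (j, i)) = P $$ (i, j)"
      using P by (metis adjoint_index)
    then show "mat_adjoint (1\<^sub>m N - P) $$ (i, j) = (1\<^sub>m N - P) $$ (i, j)"
      using ij P by (auto simp: adjoint_index[OF Q])
  qed (use P in auto)
  ultimately show ?thesis
    using Q by (simp add: projector_def)
qed

text \<open>With \<open>P\<close> idempotent,
  \<open>(1 - 2 P)\<^sup>2 = 1 - 4 P + 4 P = 1\<close>.\<close>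

lemma reflection_unitary:
  assumes "orthonormal N I f"
  shows "unitary_mat N (reflection N I f)"
proof -
  let ?P = "span_proj N I f"
  have "reflection N I f * reflection N I f
      = (1\<^sub>m N - 2 \<cdot>\<^sub>m ?P) - (1\<^sub>m N - 2 \<cdot>\<^sub>m ?P) * (2 \<cdot>\<^sub>m ?P)"
    unfolding reflection_def by (subst mult_minus_distrib_mat[of _ N N _ N]) (auto intro!: minus_carrier_mat)
  also have "(1\<^sub>m N - 2 \<cdot>\<^sub>m ?P) * (2 \<cdot>\<^sub>m ?P) = 2 \<cdot>\<^sub>m ?P - (2 \<cdot>\<^sub>m ?P) * (2 \<cdot>\<^sub>m ?P)"
    by (subst minus_mult_distrib_mat[of _ N N _ _ N]) auto
  also have "(2 \<cdot>\<^sub>m ?P) * (2 \<cdot>\<^sub>m ?P) = 2 \<cdot>\<^sub>m (?P * (2 \<cdot>\<^sub>m ?P))"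
    by (rule mult_smult_assoc_mat) auto
  also have "?P * (2 \<cdot>\<^sub>m ?P) = 2 \<cdot>\<^sub>m ?P"
    by (subst mult_smult_distrib[of _ N N _ N]) (auto simp: span_proj_idem[OF assms])
  also have "(1\<^sub>m N - 2 \<cdot>\<^sub>m ?P) - (2 \<cdot>\<^sub>m ?P - 2 \<cdot>\<^sub>m (2 \<cdot>\<^sub>m ?P)) = 1\<^sub>m N"
    by (rule eq_matI) (auto simp: span_proj_def)
  finally show ?thesis
    by (intro unitaryI_involution) (auto simp: reflection_def span_proj_def mult_ac)
qed

lemma span_proj_mult_vec:
  assumes "v \<in> carrier_vec N" "\<And>i. i \<in> I \<Longrightarrow> f i \<in> carrier_vec N"
  shows "span_proj N I f *\<^sub>v v = comb N I (\<lambda>i. v \<bullet>c f i) f"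
proof (rule eq_vecI)
  fix x assume "x < dim_vec (comb N I (\<lambda>i. v \<bullet>c f i) f)"
  then have x: "x < N"
    by (simp add: comb_def)
  then have "(span_proj N I f *\<^sub>v v) $ x = (\<Sum>y<N. \<Sum>i\<in>I. f i $ x * cnj (f i $ y) * v $ y)"
    by (simp add: mult_mat_vec_index[OF span_proj_carrier assms(1)] span_proj_index sum_distrib_right
        del: index_mult_mat_vec)
  also have "\<dots> = (\<Sum>i\<in>I. \<Sum>y<N. f i $ x * cnj (f i $ y) * v $ y)"
    by (rule sum.swap)
  also have "\<dots> = comb N I (\<lambda>i. v \<bullet>c f i) f $ x"
    unfolding comb_index[OF x]
    by (intro sum.cong refl) (simp add: cinner_sum carrier_vecD[OF assms(2)] sum_distrib_left mult_ac)
  finally show "(span_proj N I f *\<^sub>v v) $ x = comb N I (\<lambda>i. v \<bullet>c f i) f $ x" .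
qed (auto simp: span_proj_def comb_def)

lemma reflection_mult_vec:
  assumes "v \<in> carrier_vec N" "\<And>i. i \<in> I \<Longrightarrow> f i \<in> carrier_vec N"
  shows "reflection N I f *\<^sub>v v = v - comb N I (\<lambda>i. 2 * (v \<bullet>c f i)) f"
proof -
  have "reflection N I f *\<^sub>v v = 1\<^sub>m N *\<^sub>v v - (2 \<cdot>\<^sub>m span_proj N I f) *\<^sub>v v"
    unfolding reflection_def using assms by (intro minus_mult_distrib_mat_vec) auto
  also have "(2 \<cdot>\<^sub>m span_proj N I f) *\<^sub>v v = 2 \<cdot>\<^sub>v (span_proj N I f *\<^sub>v v)"
    using assms by (intro eq_vecI) (auto simp: carrier_vecD)
  also have "\<dots> = comb N I (\<lambda>i. 2 * (v \<bullet>c f i)) f"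
    using assms by (subst span_proj_mult_vec) (auto simp: comb_def sum_distrib_left mult_ac)
  finally show ?thesis
    using assms by simp
qed

text \<open>The Householder reflection along \<open>v - u\<close>.\<close>

lemma ex_unitary_mapping:
  assumes u: "u \<in> carrier_vec N" "u \<bullet>c u = 1" and v: "v \<in> carrier_vec N" "v \<bullet>c v = 1"
    and real: "u \<bullet>c v = of_real s"
  shows "\<exists>V. unitary_mat N V \<and> V *\<^sub>v u = v"
proof (cases "u = v")
  case True
  then show ?thesis
    using one_mat_unitary u(1) by (intro exI[of _ "1\<^sub>m N"]) simp
next
  case False
  have vu: "v \<bullet>c u = of_real s"
    using cinner_cnj[OF u(1) v(1)] real by simp
  \<comment> \<open>\<open>r\<close> is the squared norm of \<open>v - u\<close>. The real overlap
    makes \<open>u + v\<close> orthogonal to \<open>v - u\<close>, so that the reflection sends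
    \<open>u\<close> exactly to \<open>v\<close>.\<close>
  define r where "r = 2 - 2 * s"
  have d: "(v - u) \<bullet>c (v - u) = of_real r"
    using u v real vu by (simp add: cinner_linear[where N = N] r_def)
  have "r = (\<Sum>i<N. (cmod ((v - u) $ i))\<^sup>2)"
    using d cinner_self_real[of "v - u" N] u v by (metis minus_carrier_vec of_real_eq_iff)
  then have "r \<ge> 0"
    by (simp add: sum_nonneg)
  moreover have "r \<noteq> 0"
  proof
    assume "r = 0"
    then have "v - u = 0\<^sub>v N"
      using d u v by (intro cinner_self_eq_0) auto
    then have "(v - u) $ i = 0" if "i < N" for i
      using that by simp
    then have "u = v"
      using u v by (intro eq_vecI) auto
    then show False
      using False by simp
  qed
  ultimately have r: "r > 0"
    by simp
  define f where "f = (\<lambda>_::unit. complex_of_real (1 / sqrt r) \<cdot>\<^sub>v (v - u))"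
  have "f () \<bullet>c f () = 1"
    using u v r d
    by (simp add: f_def cinner_smult_left[where N = N] cinner_smult_right[where N = N]
        flip: of_real_mult of_real_divide)
  then have on: "orthonormal N {()} f"
    using u v by (auto simp: orthonormal_def f_def)
  \<comment> \<open>\<open>u \<bullet>c (v - u)\<close> is \<open>s - 1 = - r / 2\<close>, so twice
    the projection of \<open>u\<close> onto \<open>f ()\<close> is \<open>u - v\<close>.\<close>
  have uf: "u \<bullet>c f () = of_real (1 / sqrt r * (- (r / 2)))"
    using u v real by (simp add: f_def cinner_smult_right[where N = N] cinner_minus_right[where N = N] r_def
        diff_divide_distrib)
  have "reflection N {()} f *\<^sub>v u = u - comb N {()} (\<lambda>i. 2 * (u \<bullet>c f i)) f"
    using u v by (intro reflection_mult_vec) (auto simp: f_def)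
  also have "\<dots> = v"
  proof (rule eq_vecI)
    fix i assume "i < dim_vec v"
    then have "i < N"
      using v by simp
    have "2 * (1 / sqrt r * (- (r / 2))) * (1 / sqrt r) = - 1"
      using r by (simp add: field_simps)
    then have "complex_of_real (2 * (1 / sqrt r * (- (r / 2))) * (1 / sqrt r)) = - 1"
      by (simp only: of_real_minus of_real_1)
    then have "2 * complex_of_real (1 / sqrt r * (- (r / 2))) * (complex_of_real (1 / sqrt r) * z) = - z" for z
      by (metis mult.assoc mult_minus1 of_real_mult of_real_numeral)
    moreover have "f () $ i = complex_of_real (1 / sqrt r) * (v - u) $ i"
      using \<open>i < N\<close> u v by (simp add: f_def)
    ultimately have "(comb N {()} (\<lambda>i. 2 * (u \<bullet>c f i)) f) $ i = - ((v - u) $ i)"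
      using \<open>i < N\<close> by (simp only: comb_index uf sum.insert sum.empty finite.emptyI empty_iff if_False add_0_right
          not_False_eq_True)
    then show "(u - comb N {()} (\<lambda>i. 2 * (u \<bullet>c f i)) f) $ i = v $ i"
      using \<open>i < N\<close> u v by (simp add: comb_def)
  qed (use u v in \<open>auto simp: comb_def\<close>)
  finally show ?thesis
    using reflection_unitary[OF on] by blast
qed

section \<open>Alternating reflections\<close>

text \<open>In the plane spanned by \<open>s\<close> and its projection \<open>u\<close> to a subspace, where
  \<open>\<parallel>u\<parallel>\<^sup>2 = t\<close>, the vector \<open>a s + b u\<close> is reflected along the subspace and then along \<open>s\<close>.\<close>

primrec walk_coeff :: "real \<Rightarrow> nat \<Rightarrow> real \<times> real" where
  "walk_coeff t 0 = (1, 0)"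
| "walk_coeff t (Suc m) = (let (a, b) = walk_coeff t m in (- a + 2 * t * (2 * a + b), - 2 * a - b))"

text \<open>The overlap of \<open>a s + b u\<close> with \<open>s\<close>, since \<open>u\<close>
  has overlap \<open>t\<close> with \<open>s\<close>. For \<open>t = sin\<^sup>2 \<theta>\<close> it
  is \<open>(- 1)^m cos (2 m \<theta>)\<close>.\<close>

definition walk_amp :: "real \<Rightarrow> nat \<Rightarrow> real" where
  "walk_amp t m = fst (walk_coeff t m) + t * snd (walk_coeff t m)"

text \<open>The left-hand side is the squared norm of \<open>a s + b u\<close>, split into the part
  along \<open>s\<close> and \<open>b\<close> times \<open>u - t s\<close>, whose squared norm is
  \<open>t - t\<^sup>2\<close>. Reflections preserve it.\<close>

lemma walk_coeff_norm:
  "(walk_amp t m)\<^sup>2 + t * (1 - t) * (snd (walk_coeff t m))\<^sup>2 = 1"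
proof (induction m)
  case 0
  then show ?case
    by (simp add: walk_amp_def)
next
  case (Suc m)
  obtain a b where ab: "walk_coeff t m = (a, b)"
    by fastforce
  have "(- a + 2 * t * (2 * a + b) + t * (- 2 * a - b))\<^sup>2 + t * (1 - t) * (- 2 * a - b)\<^sup>2
      = (a + t * b)\<^sup>2 + t * (1 - t) * b\<^sup>2"
    by (simp add: power2_eq_square algebra_simps)
  then show ?case
    using Suc by (simp add: walk_amp_def ab)
qed

text \<open>A telescoping form of the Dirichlet kernel: from \<open>m\<close> to
  \<open>m + 1\<close> the right-hand side changes by \<open>2 (- 1)^m walk_amp t m\<close>.\<close>

lemma sum_walk_amp:
  "2 * (\<Sum>k<m. (- 1) ^ k * walk_amp t k)
    = 1 - (- 1) ^ m * walk_amp t m + (- 1) ^ m * (1 - t) * snd (walk_coeff t m)"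
proof (induction m)
  case 0
  then show ?case
    by (simp add: walk_amp_def)
next
  case (Suc m)
  obtain a b where ab: "walk_coeff t m = (a, b)"
    by fastforce
  define s :: real where "s = (- 1) ^ m"
  have "1 - s * (a + t * b) + s * (1 - t) * b + 2 * (s * (a + t * b))
      = 1 + s * (- a + 2 * t * (2 * a + b) + t * (- 2 * a - b)) - s * (1 - t) * (- 2 * a - b)"
    by (simp add: algebra_simps)
  then show ?case
    using Suc by (simp add: walk_amp_def ab s_def[symmetric] distrib_left)
qed

text \<open>In the closed form of the sum, the norm identity bounds \<open>walk_amp t m\<close> by 1
  and \<open>(1 - t) b\<close> by \<open>1 / sqrt t\<close>, uniformly in \<open>m\<close>.\<close>

lemma abs_sum_walk_amp_le:
  assumes "0 < t" "t \<le> 1"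
  shows "\<bar>\<Sum>k<m. (- 1) ^ k * walk_amp t k\<bar> \<le> 1 + 1 / (2 * sqrt t)"
proof -
  define b where "b = snd (walk_coeff t m)"
  have n: "(walk_amp t m)\<^sup>2 + t * (1 - t) * b\<^sup>2 = 1"
    unfolding b_def by (rule walk_coeff_norm)
  moreover have "t * (1 - t) * b\<^sup>2 \<ge> 0"
    using assms by simp
  ultimately have "(walk_amp t m)\<^sup>2 \<le> 1" and *: "t * (1 - t) * b\<^sup>2 \<le> 1"
    using zero_le_power2[of "walk_amp t m"] by linarith+
  then have c: "\<bar>walk_amp t m\<bar> \<le> 1"
    by (simp add: abs_square_le_1)
  \<comment> \<open>The square has one factor \<open>1 - t\<close> beyond the term of the norm
    identity, and this factor is at most 1.\<close>
  have "(sqrt t * ((1 - t) * b))\<^sup>2 = (1 - t) * (t * (1 - t) * b\<^sup>2)"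
    using assms by (simp add: power_mult_distrib power2_eq_square)
  also have "\<dots> \<le> 1 * 1"
    using assms * by (intro mult_mono) auto
  finally have "(sqrt t * ((1 - t) * b))\<^sup>2 \<le> 1"
    by simp
  then have "\<bar>sqrt t * ((1 - t) * b)\<bar> \<le> 1"
    by (simp only: abs_square_le_1)
  then have d: "\<bar>(1 - t) * b\<bar> \<le> 1 / sqrt t"
    using assms by (simp add: pos_le_divide_eq abs_mult[of "sqrt t"] mult.commute[of _ "sqrt t"])
  have "\<bar>1 - (- 1) ^ m * walk_amp t m + (- 1) ^ m * (1 - t) * b\<bar>
      \<le> 1 + \<bar>walk_amp t m\<bar> + \<bar>(1 - t) * b\<bar>"
  proof -
    have "\<bar>1 - s * x + s * y\<bar> \<le> 1 + \<bar>x\<bar> + \<bar>y\<bar>" if "s = 1 \<or> s = - 1" for s x y :: real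
      using that by auto
    from this[of "(- 1) ^ m" "walk_amp t m" "(1 - t) * b"] show ?thesis
      by (simp add: mult.assoc minus_one_power_iff)
  qed
  also have "\<dots> \<le> 2 + 1 / sqrt t"
    using c d by simp
  finally have "\<bar>2 * (\<Sum>k<m. (- 1) ^ k * walk_amp t k)\<bar> \<le> 2 + 1 / sqrt t"
    by (simp only: sum_walk_amp b_def)
  then show ?thesis
    by (simp add: abs_mult field_simps)
qed

text \<open>For \<open>t = 0\<close> the vector \<open>u\<close> vanishes: the reflection along the
  subspace fixes \<open>s\<close>, and the one along \<open>s\<close> negates it.\<close>

lemma walk_coeff_0: "fst (walk_coeff 0 m) = (- 1) ^ m"
  by (induction m) (auto simp: case_prod_beta)

section \<open>Superpositions over the counter: start and target states\<close>

definition walk_start :: "nat \<Rightarrow> nat \<Rightarrow> (nat \<Rightarrow> complex vec) \<Rightarrow> complex vec" where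
  "walk_start N K S = comb N {..<K} (\<lambda>k. of_real (1 / sqrt K)) S"

text \<open>The signs match those of the \<open>k\<close>-th iterate for \<open>t = 0\<close>, so
  that the walks then end exactly in this state.\<close>

definition walk_target :: "nat \<Rightarrow> nat \<Rightarrow> (nat \<Rightarrow> complex vec) \<Rightarrow> complex vec" where
  "walk_target N K S = comb N {..<K} (\<lambda>k. of_real ((- 1) ^ k / sqrt K)) S"

lemma walk_start_target_carrier [simp]:
  "walk_start N K S \<in> carrier_vec N" "walk_target N K S \<in> carrier_vec N"
  by (simp_all add: walk_start_def walk_target_def)

lemma walk_start_target_norm:
  assumes S: "orthonormal N {..<K} S" and "K > 0"
  shows "walk_start N K S \<bullet>c walk_start N K S = 1" "walk_target N K S \<bullet>c walk_target N K S = 1"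
proof -
  have S_carrier: "S k \<in> carrier_vec N" if "k < K" for k
    using S that by (simp add: orthonormal_def)
  have norm: "comb N {..<K} (\<lambda>k. of_real (c k)) S \<bullet>c comb N {..<K} (\<lambda>k. of_real (c k)) S
      = (\<Sum>k<K. of_real ((c k)\<^sup>2))" for c
  proof -
    have "comb N {..<K} (\<lambda>k. of_real (c k)) S \<bullet>c S k = of_real (c k)" if "k < K" for k
    proof -
      have "comb N {..<K} (\<lambda>k. of_real (c k)) S \<bullet>c S k = (\<Sum>l<K. of_real (c l) * (S l \<bullet>c S k))"
        using that S_carrier by (intro cinner_comb_left) auto
      also have "\<dots> = (\<Sum>l<K. if l = k then of_real (c k) else 0)"
        using that S by (intro sum.cong refl) (auto simp: orthonormal_def)
      finally show ?thesis
        using that by simp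
    qed
    then show ?thesis
      using S_carrier by (subst cinner_comb_right) (auto simp: power2_eq_square)
  qed
  have *: "comb N {..<K} (\<lambda>k. of_real (c k)) S \<bullet>c comb N {..<K} (\<lambda>k. of_real (c k)) S = 1"
    if "\<And>k. (c k)\<^sup>2 = 1 / K" for c
    using assms(2) by (simp only: norm that) simp
  show "walk_start N K S \<bullet>c walk_start N K S = 1"
    unfolding walk_start_def by (rule *) (simp add: power_divide)
  show "walk_target N K S \<bullet>c walk_target N K S = 1"
    unfolding walk_target_def by (rule *) (simp add: power_divide mult.commute flip: power_mult)
qed

text \<open>\<open>K\<close> copies of the same two-dimensional picture run in parallel: the step number \<open>j\<close> leaves
  the copies \<open>k \<le> j\<close> alone, so that the copy number \<open>k\<close> takes part in \<open>k\<close> steps.\<close>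

locale parallel_walks =
  fixes N K n :: nat and A :: "complex mat" and S :: "nat \<Rightarrow> complex vec"
    and G :: "nat \<times> nat \<Rightarrow> complex vec" and \<gamma> :: "nat \<Rightarrow> real"
  assumes A: "unitary_mat N A"
    and S: "orthonormal N {..<K} S"
    and G: "orthonormal N ({..<n} \<times> {..<K}) G"
    and overlap: "\<And>i k l. i < n \<Longrightarrow> k < K \<Longrightarrow> l < K \<Longrightarrow>
      (A *\<^sub>v S l) \<bullet>c G (i, k) = (if k = l then of_real (\<gamma> i) else 0)"
begin

text \<open>The squared norm of \<open>U k\<close> below, the same in every copy.\<close>

definition t :: real where
  "t = (\<Sum>i<n. (\<gamma> i)\<^sup>2)"

text \<open>By \<open>overlap\<close>, the projection of \<open>A *\<^sub>v S k\<close> onto the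
  span of the vectors \<open>G\<close>.\<close>

definition U :: "nat \<Rightarrow> complex vec" where
  "U k = comb N {..<n} (\<lambda>i. of_real (\<gamma> i)) (\<lambda>i. G (i, k))"

text \<open>Pulled back by \<open>A\<close>, this is the vector u of the plane of copy
  \<open>k\<close>, where \<open>S k\<close> is s.\<close>

definition W :: "nat \<Rightarrow> complex vec" where
  "W k = mat_adjoint A *\<^sub>v U k"

definition state :: "(nat \<Rightarrow> real) \<Rightarrow> (nat \<Rightarrow> real) \<Rightarrow> complex vec" where
  "state a b = comb N {..<K} (\<lambda>k. of_real (a k)) S + comb N {..<K} (\<lambda>k. of_real (b k)) W"

text \<open>On the copies \<open>k \<le> j\<close> neither reflection acts, and \<open>A\<close>
  cancels with its adjoint.\<close>

definition step :: "nat \<Rightarrow> complex vec \<Rightarrow> complex vec" where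
  "step j v = reflection N {j<..<K} S *\<^sub>v
    (mat_adjoint A *\<^sub>v (reflection N ({..<n} \<times> {j<..<K}) G *\<^sub>v (A *\<^sub>v v)))"

lemma A_carrier [simp]: "A \<in> carrier_mat N N"
  by (rule unitary_carrier[OF A])

lemma carriers [simp]:
  "A \<in> carrier_mat N N" "k < K \<Longrightarrow> S k \<in> carrier_vec N"
  "i < n \<Longrightarrow> k < K \<Longrightarrow> G (i, k) \<in> carrier_vec N" "U k \<in> carrier_vec N" "W k \<in> carrier_vec N"
  "state a b \<in> carrier_vec N"
  using S G by (auto simp: orthonormal_def U_def W_def state_def
      intro!: mult_mat_vec_carrier[of _ N N])

lemma state_dim [simp]: "dim_vec (state a b) = N"
  by (rule carrier_vecD) simp

lemma S_orth: "k < K \<Longrightarrow> l < K \<Longrightarrow> S k \<bullet>c S l = (if k = l then 1 else 0)"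
  using S by (auto simp: orthonormal_def)

lemma U_cinner_G:
  assumes "i < n" "k < K" "l < K"
  shows "U l \<bullet>c G (i, k) = (if k = l then of_real (\<gamma> i) else 0)"
proof -
  have "U l \<bullet>c G (i, k) = (\<Sum>j<n. of_real (\<gamma> j) * (G (j, l) \<bullet>c G (i, k)))"
    using assms unfolding U_def by (intro cinner_comb_left) auto
  also have "\<dots> = (\<Sum>j<n. if j = i then (if k = l then of_real (\<gamma> i) else 0) else 0)"
    using assms G by (intro sum.cong refl) (auto simp: orthonormal_def)
  also have "\<dots> = (if k = l then of_real (\<gamma> i) else 0)"
    using assms by simp
  finally show ?thesis .
qed

text \<open>Moving \<open>A\<close> to the other argument gives
  \<open>U l \<bullet>c (A *\<^sub>v S k)\<close>. For \<open>k = l\<close> this pairs a projection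
  with the vector it comes from, which yields its squared norm.\<close>

lemma W_cinner_S:
  assumes "k < K" "l < K"
  shows "W l \<bullet>c S k = (if k = l then of_real t else 0)"
proof -
  have "W l \<bullet>c S k = U l \<bullet>c (mat_adjoint (mat_adjoint A) *\<^sub>v S k)"
    unfolding W_def using assms by (intro cinner_adjoint[of _ N N]) auto
  also have "mat_adjoint (mat_adjoint A) = A"
    by (rule adjoint_adjoint[of _ N N]) simp
  also have "U l \<bullet>c (A *\<^sub>v S k) = (\<Sum>i<n. of_real (\<gamma> i) * (G (i, l) \<bullet>c (A *\<^sub>v S k)))"
    using assms unfolding U_def by (intro cinner_comb_left) (auto intro!: mult_mat_vec_carrier[of _ N N])
  also have "\<dots> = (\<Sum>i<n. if k = l then of_real ((\<gamma> i)\<^sup>2) else 0)"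
  proof (intro sum.cong refl)
    fix i assume "i \<in> {..<n}"
    then have "i < n"
      by simp
    then have "G (i, l) \<bullet>c (A *\<^sub>v S k) = cnj ((A *\<^sub>v S k) \<bullet>c G (i, l))"
      using assms by (intro cinner_cnj[where N = N]) (auto intro!: mult_mat_vec_carrier[of _ N N])
    then show "of_real (\<gamma> i) * (G (i, l) \<bullet>c (A *\<^sub>v S k)) = (if k = l then of_real ((\<gamma> i)\<^sup>2) else 0)"
      using overlap[OF \<open>i < n\<close> assms(2,1)] by (auto simp: power2_eq_square)
  qed
  also have "\<dots> = (if k = l then of_real t else 0)"
    by (simp add: t_def)
  finally show ?thesis .
qed

lemma A_state:
  "A *\<^sub>v state a b
    = comb N {..<K} (\<lambda>k. of_real (a k)) (\<lambda>k. A *\<^sub>v S k) + comb N {..<K} (\<lambda>k. of_real (b k)) U"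
proof -
  have "A *\<^sub>v W k = U k" for k
    unfolding W_def using A by (intro unitary_mult_adjoint_vec) auto
  moreover have "A *\<^sub>v comb N {..<K} c S = comb N {..<K} c (\<lambda>k. A *\<^sub>v S k)"
    and "A *\<^sub>v comb N {..<K} c W = comb N {..<K} c (\<lambda>k. A *\<^sub>v W k)" for c
    by (intro mult_comb; auto)+
  ultimately show ?thesis
    unfolding state_def by (subst mult_add_distrib_mat_vec[of _ N N]) auto
qed

lemma A_state_cinner_G:
  assumes "i < n" "k < K"
  shows "(A *\<^sub>v state a b) \<bullet>c G (i, k) = of_real ((a k + b k) * \<gamma> i)"
proof -
  have "(A *\<^sub>v state a b) \<bullet>c G (i, k)
      = (\<Sum>l<K. of_real (a l) * ((A *\<^sub>v S l) \<bullet>c G (i, k))) + (\<Sum>l<K. of_real (b l) * (U l \<bullet>c G (i, k)))"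
    unfolding A_state using assms
    by (subst cinner_add_left[where N = N]) (auto intro!: cinner_comb_left mult_mat_vec_carrier[of _ N N] arg_cong2[where f = "(+)"])
  also have "\<dots> = (\<Sum>l<K. if l = k then of_real (a k * \<gamma> i) else 0) + (\<Sum>l<K. if l = k then of_real (b k * \<gamma> i) else 0)"
    using assms by (intro arg_cong2[where f = "(+)"] sum.cong refl) (auto simp: overlap U_cinner_G)
  also have "\<dots> = of_real ((a k + b k) * \<gamma> i)"
    using assms by (simp add: algebra_simps)
  finally show ?thesis .
qed

lemma state_cinner_S:
  assumes "k < K"
  shows "state a b \<bullet>c S k = of_real (a k + t * b k)"
proof -
  have "state a b \<bullet>c S k
      = (\<Sum>l<K. of_real (a l) * (S l \<bullet>c S k)) + (\<Sum>l<K. of_real (b l) * (W l \<bullet>c S k))"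
    unfolding state_def using assms
    by (subst cinner_add_left[where N = N]) (auto intro!: cinner_comb_left arg_cong2[where f = "(+)"])
  also have "\<dots> = (\<Sum>l<K. if l = k then of_real (a k) else 0) + (\<Sum>l<K. if l = k then of_real (t * b k) else 0)"
    using assms by (intro arg_cong2[where f = "(+)"] sum.cong refl) (auto simp: S_orth W_cinner_S)
  also have "\<dots> = of_real (a k + t * b k)"
    using assms by simp
  finally show ?thesis .
qed

text \<open>In copy \<open>k\<close> the component of \<open>A *\<^sub>v state a b\<close> along the
  vectors \<open>G\<close> is \<open>a k + b k\<close> times \<open>U k\<close>; negating it takes
  \<open>b\<close> to \<open>b - 2 (a + b)\<close> and leaves \<open>a\<close>.\<close>

lemma reflect_G_state:
  "reflection N ({..<n} \<times> {j<..<K}) G *\<^sub>v (A *\<^sub>v state a b)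
    = A *\<^sub>v state a (\<lambda>k. if j < k then - 2 * a k - b k else b k)"
proof -
  let ?b = "\<lambda>k. if j < k then - 2 * a k - b k else b k"
  let ?I = "{..<n} \<times> {j<..<K}"
  have "reflection N ?I G *\<^sub>v (A *\<^sub>v state a b)
      = A *\<^sub>v state a b - comb N ?I (\<lambda>i. 2 * ((A *\<^sub>v state a b) \<bullet>c G i)) G"
    by (intro reflection_mult_vec mult_mat_vec_carrier[of _ N N]) auto
  also have "\<dots> = A *\<^sub>v state a ?b"
  proof (rule eq_vecI)
    fix x assume "x < dim_vec (A *\<^sub>v state a ?b)"
    then have x: "x < N"
      using carrier_matD(1)[OF carriers(1)] by simp
    have "comb N ?I (\<lambda>i. 2 * ((A *\<^sub>v state a b) \<bullet>c G i)) G $ x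
        = (\<Sum>(i, k)\<in>?I. 2 * of_real ((a k + b k) * \<gamma> i) * G (i, k) $ x)"
      using x by (auto simp: comb_def A_state_cinner_G intro!: sum.cong)
    also have "\<dots> = (\<Sum>k\<in>{j<..<K}. \<Sum>i<n. 2 * of_real ((a k + b k) * \<gamma> i) * G (i, k) $ x)"
      by (simp add: sum.cartesian_product[symmetric] sum.swap[of _ "{..<n}"])
    also have "\<dots> = (\<Sum>k\<in>{j<..<K}. 2 * of_real (a k + b k) * U k $ x)"
      unfolding U_def comb_index[OF x] sum_distrib_left by (intro sum.cong refl) (simp add: mult_ac)
    \<comment> \<open>The sum is extended to all copies: for \<open>k \<le> j\<close> the old and
      the new coefficient agree, so the added terms vanish.\<close>
    also have "\<dots> = (\<Sum>k<K. if j < k then 2 * of_real (a k + b k) * U k $ x else 0)"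
      by (intro sum.mono_neutral_cong_left) auto
    also have "\<dots> = (\<Sum>k<K. (of_real (b k) - of_real (?b k)) * U k $ x)"
      by (intro sum.cong refl) (simp add: algebra_simps)
    finally have "comb N ?I (\<lambda>i. 2 * ((A *\<^sub>v state a b) \<bullet>c G i)) G $ x
        = (\<Sum>k<K. of_real (b k) * U k $ x) - (\<Sum>k<K. of_real (?b k) * U k $ x)"
      by (simp only: left_diff_distrib sum_subtractf)
    then show "(A *\<^sub>v state a b - comb N ?I (\<lambda>i. 2 * ((A *\<^sub>v state a b) \<bullet>c G i)) G) $ x
        = (A *\<^sub>v state a ?b) $ x"
      using x unfolding A_state comb_def by simp
  qed (use carrier_matD(1)[OF carriers(1)] in \<open>simp add: comb_def\<close>)
  finally show ?thesis .
qed

text \<open>The component along \<open>S k\<close> is \<open>a k + t * b k\<close>; twice this is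
  subtracted from \<open>a k\<close>.\<close>

lemma reflect_S_state:
  "reflection N {j<..<K} S *\<^sub>v state a b
    = state (\<lambda>k. if j < k then - a k - 2 * t * b k else a k) b"
proof -
  let ?a = "\<lambda>k. if j < k then - a k - 2 * t * b k else a k"
  have "reflection N {j<..<K} S *\<^sub>v state a b
      = state a b - comb N {j<..<K} (\<lambda>k. 2 * (state a b \<bullet>c S k)) S"
    by (intro reflection_mult_vec) auto
  also have "\<dots> = state ?a b"
  proof (rule eq_vecI)
    fix x assume "x < dim_vec (state ?a b)"
    then have x: "x < N"
      by simp
    have "comb N {j<..<K} (\<lambda>k. 2 * (state a b \<bullet>c S k)) S $ x
        = (\<Sum>k\<in>{j<..<K}. 2 * of_real (a k + t * b k) * S k $ x)"
      using x by (auto simp: comb_def state_cinner_S intro!: sum.cong)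
    also have "\<dots> = (\<Sum>k<K. if j < k then 2 * of_real (a k + t * b k) * S k $ x else 0)"
      by (intro sum.mono_neutral_cong_left) auto
    also have "\<dots> = (\<Sum>k<K. (of_real (a k) - of_real (?a k)) * S k $ x)"
      by (intro sum.cong refl) (simp add: algebra_simps)
    finally have "comb N {j<..<K} (\<lambda>k. 2 * (state a b \<bullet>c S k)) S $ x
        = (\<Sum>k<K. of_real (a k) * S k $ x) - (\<Sum>k<K. of_real (?a k) * S k $ x)"
      by (simp only: left_diff_distrib sum_subtractf)
    then show "(state a b - comb N {j<..<K} (\<lambda>k. 2 * (state a b \<bullet>c S k)) S) $ x = state ?a b $ x"
      using x unfolding state_def comb_def by simp
  qed (simp add: comb_def)
  finally show ?thesis .
qed

lemma step_state:
  "step j (state a b) = state (\<lambda>k. if j < k then - a k + 2 * t * (2 * a k + b k) else a k)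
    (\<lambda>k. if j < k then - 2 * a k - b k else b k)"
proof -
  have "step j (state a b) = reflection N {j<..<K} S *\<^sub>v
      state a (\<lambda>k. if j < k then - 2 * a k - b k else b k)"
    unfolding step_def reflect_G_state by (subst unitary_adjoint_mult_vec[OF A]) auto
  also have "\<dots> = state (\<lambda>k. if j < k then - a k + 2 * t * (2 * a k + b k) else a k)
      (\<lambda>k. if j < k then - 2 * a k - b k else b k)"
    unfolding reflect_S_state
    by (intro arg_cong2[where f = state] ext) (auto simp: algebra_simps)
  finally show ?thesis .
qed

text \<open>Copy \<open>k\<close> moves in the steps \<open>j < k\<close> only; among the steps
  below \<open>m\<close> there are \<open>min k m\<close> of these.\<close>

lemma fold_step:
  "m \<le> K \<Longrightarrow> fold step [0..<m] (walk_start N K S)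
    = state (\<lambda>k. fst (walk_coeff t (min k m)) / sqrt K) (\<lambda>k. snd (walk_coeff t (min k m)) / sqrt K)"
proof (induction m)
  case 0
  then show ?case
    by (auto simp: walk_start_def state_def comb_def)
next
  case (Suc m)
  have min: "min k (Suc m) = (if m < k then Suc m else k)" "min k m = (if m < k then m else k)" for k
    by auto
  have "fold step [0..<Suc m] (walk_start N K S) = step m (fold step [0..<m] (walk_start N K S))"
    by simp
  also have "\<dots> = step m (state (\<lambda>k. fst (walk_coeff t (min k m)) / sqrt K) (\<lambda>k. snd (walk_coeff t (min k m)) / sqrt K))"
    using Suc by simp
  also have "\<dots> = state (\<lambda>k. fst (walk_coeff t (min k (Suc m))) / sqrt K) (\<lambda>k. snd (walk_coeff t (min k (Suc m))) / sqrt K)"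
    unfolding step_state by (intro arg_cong2[where f = state] ext)
      (auto simp: min case_prod_beta diff_divide_distrib add_divide_distrib algebra_simps)
  finally show ?case .
qed

lemma final_amplitude:
  "fold step [0..<K] (walk_start N K S) \<bullet>c walk_target N K S = of_real ((\<Sum>k<K. (- 1) ^ k * walk_amp t k) / K)"
proof -
  have "fold step [0..<K] (walk_start N K S) \<bullet>c walk_target N K S
      = (\<Sum>k<K. of_real ((- 1) ^ k / sqrt K) * (fold step [0..<K] (walk_start N K S) \<bullet>c S k))"
    unfolding walk_target_def by (subst cinner_comb_right) (auto simp: fold_step simp flip: of_real_power)
  also have "\<dots> = (\<Sum>k<K. of_real ((- 1) ^ k * walk_amp t k / K))"
  proof (intro sum.cong refl)
    fix k assume "k \<in> {..<K}"
    then have k: "k < K"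
      by simp
    \<comment> \<open>After all \<open>K\<close> steps, copy \<open>k\<close> is at its
      \<open>k\<close>-th iterate, as \<open>min k K = k\<close>.\<close>
    then have "fold step [0..<K] (walk_start N K S) \<bullet>c S k = of_real (walk_amp t k / sqrt K)"
      by (simp only: fold_step order_refl state_cinner_S) (simp add: walk_amp_def add_divide_distrib)
    moreover have "(- 1) ^ k / sqrt K * (walk_amp t k / sqrt K) = (- 1) ^ k * walk_amp t k / K"
      by simp
    ultimately show "of_real ((- 1) ^ k / sqrt K) * (fold step [0..<K] (walk_start N K S) \<bullet>c S k)
        = complex_of_real ((- 1) ^ k * walk_amp t k / K)"
      by (metis of_real_mult)
  qed
  also have "\<dots> = of_real ((\<Sum>k<K. (- 1) ^ k * walk_amp t k) / K)"
    by (simp only: sum_divide_distrib of_real_sum)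
  finally show ?thesis .
qed

end

section \<open>Controlled swaps and conjugated queries\<close>

text \<open>The index \<open>x * w + (c * n + l) * K + k\<close> stands for a basis vector \<open>x\<close> of
  (control qubit) \<open>\<otimes> A \<otimes> B\<close>, whose \<open>B\<close>-part is \<open>x mod n\<close>, and a workspace
  that consists of a qubit \<open>c\<close>, a copy \<open>l\<close> of \<open>B\<close>, and a counter \<open>k\<close>.\<close>

locale workspace =
  fixes m n K :: nat
  assumes n: "n > 0" and K: "K > 0"
begin

definition w :: nat where
  "w = 2 * n * K"

abbreviation N :: nat where
  "N \<equiv> 2 * m * w"

definition slot :: "nat \<Rightarrow> nat \<Rightarrow> nat \<Rightarrow> nat" where
  "slot c l k = (c * n + l) * K + k"

text \<open>The value of the selecting qubit \<open>c\<close> in the index \<open>X\<close>.\<close>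

definition sector :: "nat \<Rightarrow> nat" where
  "sector X = X mod w div K div n"

lemma w_pos: "w > 0"
  using n K by (simp add: w_def)

lemma slot_less:
  assumes "c < 2" "l < n" "k < K"
  shows "slot c l k < w"
proof -
  have "c * n + l < (c + 1) * n"
    using assms by simp
  also have "\<dots> \<le> 2 * n"
    using assms by (intro mult_right_mono) auto
  finally have "c * n + l + 1 \<le> 2 * n"
    by simp
  then have "(c * n + l + 1) * K \<le> 2 * n * K"
    by (rule mult_right_mono) simp
  then show ?thesis
    using assms by (simp add: slot_def w_def add_mult_distrib)
qed

lemma slot_div_mod [simp]:
  assumes "l < n" "k < K"
  shows "slot c l k div K = c * n + l" "slot c l k mod K = k" "(c * n + l) div n = c" "(c * n + l) mod n = l"
  using assms by (simp_all add: slot_def)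

lemma slot_inject:
  "l < n \<Longrightarrow> k < K \<Longrightarrow> l' < n \<Longrightarrow> k' < K \<Longrightarrow> slot c l k = slot c' l' k' \<longleftrightarrow> c = c' \<and> l = l' \<and> k = k'"
  by (metis slot_div_mod)

lemma slot_surj: "slot (y div K div n) (y div K mod n) (y mod K) = y"
  by (simp add: slot_def)

text \<open>In the sector \<open>c\<close>, the copy register exchanges its value 0 with the
  \<open>B\<close>-value of \<open>X\<close>. Starting from 0 this writes the
  \<open>B\<close>-value, which is the copying; being a transposition, it is self-inverse.\<close>

definition swap_index :: "nat \<Rightarrow> nat \<Rightarrow> nat" where
  "swap_index c X = (if sector X = c
     then X div w * w + slot c (Transposition.transpose 0 (X div w mod n) (X mod w div K mod n)) (X mod w mod K)
     else X)"

lemma sector_less: "sector X < 2"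
  unfolding sector_def using w_pos mod_less_divisor[of w X]
  by (intro div_less_prod) (simp add: w_def)

lemma transpose_less: "i < n \<Longrightarrow> j < n \<Longrightarrow> Transposition.transpose 0 i j < n"
  using n by (auto simp: transpose_def)

lemma swap_index_parts:
  assumes "sector X = c"
  shows "swap_index c X div w = X div w"
    "swap_index c X mod w
      = slot c (Transposition.transpose 0 (X div w mod n) (X mod w div K mod n)) (X mod w mod K)"
proof -
  have "slot c (Transposition.transpose 0 (X div w mod n) (X mod w div K mod n)) (X mod w mod K) < w"
    using assms sector_less n K by (intro slot_less transpose_less) auto
  then show "swap_index c X div w = X div w"
    "swap_index c X mod w
      = slot c (Transposition.transpose 0 (X div w mod n) (X mod w div K mod n)) (X mod w mod K)"
    using assms by (simp_all add: swap_index_def)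
qed

lemma swap_index_sector: "sector (swap_index c X) = sector X"
proof (cases "sector X = c")
  case True
  then show ?thesis
    unfolding sector_def[of "swap_index c X"] swap_index_parts[OF True]
    using n K by (simp add: transpose_less)
qed (simp add: swap_index_def)

text \<open>The \<open>B\<close>-part survives the first application, so the second one applies the
  same transposition.\<close>

lemma swap_index_involution: "swap_index c (swap_index c X) = X"
proof (cases "sector X = c")
  case True
  let ?Y = "swap_index c X"
  have Y: "sector ?Y = c"
    using True swap_index_sector by simp
  have "swap_index c ?Y = X div w * w + slot c (X mod w div K mod n) (X mod w mod K)"
    unfolding swap_index_def[of c ?Y] swap_index_parts[OF True] using Y n K
    by (simp add: transpose_less)
  also have "slot c (X mod w div K mod n) (X mod w mod K) = X mod w"
    using slot_surj[of "X mod w"] True by (simp add: sector_def)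
  finally show ?thesis
    by (simp only: div_mult_mod_eq)
qed (simp add: swap_index_def)

lemma swap_index_div: "swap_index c X div w = X div w"
proof (cases "sector X = c")
  case True
  then show ?thesis
    by (rule swap_index_parts(1))
qed (simp add: swap_index_def)

lemma swap_index_less: "X < N \<Longrightarrow> swap_index c X < N"
  using w_pos by (metis div_less_iff_less_mult swap_index_div)

definition swap_gate :: "nat \<Rightarrow> complex mat" where
  "swap_gate c = mat N N (\<lambda>(X, Y). if Y = swap_index c X then 1 else 0)"

lemma swap_gate_carrier [simp]: "swap_gate c \<in> carrier_mat N N"
  by (simp add: swap_gate_def)

lemma swap_gate_index:
  "X < N \<Longrightarrow> Y < N \<Longrightarrow> swap_gate c $$ (X, Y) = (if Y = swap_index c X then 1 else 0)"
  by (simp add: swap_gate_def)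

lemma swap_gate_mult_vec:
  assumes "v \<in> carrier_vec N" "X < N"
  shows "(swap_gate c *\<^sub>v v) $ X = v $ swap_index c X"
proof -
  have "(swap_gate c *\<^sub>v v) $ X = (\<Sum>Y<N. swap_gate c $$ (X, Y) * v $ Y)"
    using assms by (intro mult_mat_vec_index[of _ N N]) auto
  also have "\<dots> = (\<Sum>Y<N. if Y = swap_index c X then v $ Y else 0)"
    using assms by (intro sum.cong refl) (auto simp: swap_gate_index)
  also have "\<dots> = v $ swap_index c X"
    using swap_index_less[OF assms(2)] by simp
  finally show ?thesis .
qed

lemma swap_gate_unitary: "unitary_mat N (swap_gate c)" "mat_adjoint (swap_gate c) = swap_gate c"
proof -
  have "swap_gate c * swap_gate c = 1\<^sub>m N"
  proof (rule eq_matI)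
    fix X Y assume "X < dim_row (1\<^sub>m N :: complex mat)" "Y < dim_col (1\<^sub>m N :: complex mat)"
    then have XY: "X < N" "Y < N"
      by auto
    have "(swap_gate c * swap_gate c) $$ (X, Y) = (\<Sum>Z<N. swap_gate c $$ (X, Z) * swap_gate c $$ (Z, Y))"
      using XY by (intro mult_mat_index[of _ N N]) auto
    also have "\<dots> = (\<Sum>Z<N. if Z = swap_index c X then (if X = Y then 1 else 0) else 0)"
      using XY by (intro sum.cong refl) (auto simp: swap_gate_index swap_index_involution)
    also have "\<dots> = 1\<^sub>m N $$ (X, Y)"
      using XY swap_index_less[OF XY(1)] by simp
    finally show "(swap_gate c * swap_gate c) $$ (X, Y) = 1\<^sub>m N $$ (X, Y)" .
  qed (auto simp: swap_gate_def)
  moreover have "cnj (swap_gate c $$ (Y, X)) = swap_gate c $$ (X, Y)" if "X < N" "Y < N" for X Y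
    using that by (auto simp: swap_gate_index swap_index_involution)
  ultimately show "unitary_mat N (swap_gate c)" "mat_adjoint (swap_gate c) = swap_gate c"
    by (auto intro: unitaryI_involution[of _ N])
qed

section \<open>Vectors confined to one value of the selecting qubit\<close>

definition supported :: "nat \<Rightarrow> complex vec \<Rightarrow> bool" where
  "supported c v \<longleftrightarrow> v \<in> carrier_vec N \<and> (\<forall>X<N. sector X \<noteq> c \<longrightarrow> v $ X = 0)"

definition place :: "complex vec \<Rightarrow> nat \<Rightarrow> nat \<Rightarrow> nat \<Rightarrow> complex vec" where
  "place v c l k = v \<otimes>\<^sub>v unit_vec w (slot c l k)"

lemma place_carrier [simp]: "v \<in> carrier_vec (2 * m) \<Longrightarrow> place v c l k \<in> carrier_vec N"
  unfolding place_def by (intro tensor_vec_carrier) auto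

lemma place_index:
  "v \<in> carrier_vec (2 * m) \<Longrightarrow> X < N \<Longrightarrow>
    place v c l k $ X = (if X mod w = slot c l k then v $ (X div w) else 0)"
  using w_pos by (auto simp: place_def tensor_vec_def unit_vec_def)

lemma place_supported:
  "v \<in> carrier_vec (2 * m) \<Longrightarrow> l < n \<Longrightarrow> k < K \<Longrightarrow> supported c (place v c l k)"
  by (auto simp: supported_def place_index sector_def)

lemma swap_supported:
  "supported c v \<Longrightarrow> supported c (swap_gate c' *\<^sub>v v)"
  unfolding supported_def
  by (auto simp: swap_gate_mult_vec swap_index_sector swap_index_less
      intro!: mult_mat_vec_carrier[of _ N N] simp del: index_mult_mat_vec)

lemma swap_other_sector:
  assumes "supported c v" "c \<noteq> c'"
  shows "swap_gate c' *\<^sub>v v = v"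
proof (rule eq_vecI)
  fix X assume "X < dim_vec v"
  then have X: "X < N" and v: "v \<in> carrier_vec N"
    using assms by (auto simp: supported_def)
  have "v $ swap_index c' X = v $ X"
  proof (cases "sector X = c'")
    case True
    then have "v $ swap_index c' X = 0" "v $ X = 0"
      using assms X swap_index_less[OF X] swap_index_sector by (auto simp: supported_def)
    then show ?thesis
      by simp
  qed (simp add: swap_index_def)
  then show "(swap_gate c' *\<^sub>v v) $ X = v $ X"
    by (simp only: swap_gate_mult_vec[OF v X])
qed (use assms in \<open>auto simp: supported_def swap_gate_def\<close>)

lemma cinner_other_sector:
  assumes "supported c v" "supported c' v'" "c \<noteq> c'"
  shows "v \<bullet>c v' = 0"
proof -
  have "v $ X * cnj (v' $ X) = 0" if "X < N" for X
    using assms that unfolding supported_def by (metis complex_cnj_zero mult_zero_left mult_zero_right)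
  moreover have "dim_vec v' = N"
    using assms by (simp add: supported_def)
  ultimately show ?thesis
    unfolding cinner_sum by (intro sum.neutral) auto
qed

section \<open>Queries lifted to the whole space, and conjugation of the swap by them\<close>

definition lift :: "complex mat \<Rightarrow> complex mat" where
  "lift U = (1\<^sub>m 2 \<otimes>\<^sub>m U) \<otimes>\<^sub>m 1\<^sub>m w"

lemma lift_unitary: "unitary_mat m U \<Longrightarrow> unitary_mat N (lift U)"
  unfolding lift_def by (intro tensor_mat_unitary one_mat_unitary)

lemma lift_adjoint:
  assumes "U \<in> carrier_mat m m"
  shows "lift (mat_adjoint U) = mat_adjoint (lift U)"
proof -
  have "mat_adjoint (1\<^sub>m k) = (1\<^sub>m k :: complex mat)" for k
    by (rule unitaryI_involution(2)[of _ k]) auto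
  then show ?thesis
    unfolding lift_def
    by (simp only: tensor_mat_adjoint[OF tensor_mat_carrier[OF one_carrier_mat assms] one_carrier_mat]
        tensor_mat_adjoint[OF one_carrier_mat assms])
qed

lemma lift_place:
  assumes "U \<in> carrier_mat m m" "v \<in> carrier_vec (2 * m)"
  shows "lift U *\<^sub>v place v c l k = place ((1\<^sub>m 2 \<otimes>\<^sub>m U) *\<^sub>v v) c l k"
  unfolding lift_def place_def
  by (simp add: tensor_mat_mult_vec[OF tensor_mat_carrier[OF one_carrier_mat assms(1)] one_carrier_mat
      assms(2) unit_vec_carrier])

text \<open>An entry of \<open>lift U\<close> vanishes unless both indices agree modulo
  \<open>w\<close>, and the sector depends on that remainder alone.\<close>

lemma lift_supported:
  assumes "U \<in> carrier_mat m m" "supported c v"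
  shows "supported c (lift U *\<^sub>v v)"
proof -
  have U: "1\<^sub>m 2 \<otimes>\<^sub>m U \<in> carrier_mat (2 * m) (2 * m)"
    by (rule tensor_mat_carrier[OF one_carrier_mat assms(1)])
  have L: "lift U \<in> carrier_mat N N"
    unfolding lift_def by (rule tensor_mat_carrier[OF U one_carrier_mat])
  have v: "v \<in> carrier_vec N"
    using assms by (simp add: supported_def)
  have "(lift U *\<^sub>v v) $ X = 0" if X: "X < N" "sector X \<noteq> c" for X
  proof -
    have "(lift U *\<^sub>v v) $ X = (\<Sum>Y<N. lift U $$ (X, Y) * v $ Y)"
      using X by (intro mult_mat_vec_index[OF L v])
    also have "\<dots> = 0"
    proof (intro sum.neutral ballI)
      fix Y assume "Y \<in> {..<N}"
      then have Y: "Y < N"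
        by simp
      show "lift U $$ (X, Y) * v $ Y = 0"
      proof (cases "X mod w = Y mod w")
        case True
        then have "v $ Y = 0"
          using assms X Y by (auto simp: supported_def sector_def)
        then show ?thesis
          by simp
      next
        case False
        then have "lift U $$ (X, Y) = 0"
          unfolding lift_def using X Y w_pos by (subst tensor_mat_index[OF U one_carrier_mat]) auto
        then show ?thesis
          by simp
      qed
    qed
    finally show ?thesis .
  qed
  then show ?thesis
    unfolding supported_def using L v by (auto intro!: mult_mat_vec_carrier simp del: index_mult_mat_vec)
qed

definition conj_swap :: "nat \<Rightarrow> complex mat \<Rightarrow> complex mat" where
  "conj_swap c U = mat_adjoint (lift U) * (swap_gate c * lift U)"

context
  fixes U :: "complex mat"
  assumes U: "unitary_mat m U"
begin

lemma U_carrier: "U \<in> carrier_mat m m"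
  by (rule unitary_carrier[OF U])

lemma lift_carrier [simp]: "lift U \<in> carrier_mat N N"
  by (rule unitary_carrier[OF lift_unitary[OF U]])

lemma conj_swap_unitary: "unitary_mat N (conj_swap c U)"
  unfolding conj_swap_def
  by (intro unitary_mult(1) unitary_adjoint lift_unitary swap_gate_unitary U)

text \<open>A conjugate of a self-adjoint gate is self-adjoint, so the operator is its own inverse
  and is undone by repeating it.\<close>

lemma conj_swap_adjoint: "mat_adjoint (conj_swap c U) = conj_swap c U"
proof -
  note L = lift_unitary[OF U]
  have "mat_adjoint (conj_swap c U) = mat_adjoint (swap_gate c * lift U) * mat_adjoint (mat_adjoint (lift U))"
    unfolding conj_swap_def
    by (intro unitary_mult(2)[of N] unitary_mult(1) unitary_adjoint L swap_gate_unitary)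
  also have "mat_adjoint (mat_adjoint (lift U)) = lift U"
    by (intro adjoint_adjoint[of _ N N]) simp
  also have "mat_adjoint (swap_gate c * lift U) = mat_adjoint (lift U) * swap_gate c"
    using unitary_mult(2)[OF swap_gate_unitary(1) L] by (simp add: swap_gate_unitary)
  also have "\<dots> * lift U = conj_swap c U"
    unfolding conj_swap_def by (intro assoc_mult_mat[of _ N N _ N _ N]) auto
  finally show ?thesis .
qed

lemma conj_swap_mult_vec:
  assumes "v \<in> carrier_vec N"
  shows "conj_swap c U *\<^sub>v v = mat_adjoint (lift U) *\<^sub>v (swap_gate c *\<^sub>v (lift U *\<^sub>v v))"
proof -
  have "conj_swap c U *\<^sub>v v = mat_adjoint (lift U) *\<^sub>v ((swap_gate c * lift U) *\<^sub>v v)"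
    unfolding conj_swap_def using assms
    by (intro assoc_mult_mat_vec[of _ N N _ N] mult_carrier_mat[of _ N N _ N]) auto
  also have "(swap_gate c * lift U) *\<^sub>v v = swap_gate c *\<^sub>v (lift U *\<^sub>v v)"
    using assms by (intro assoc_mult_mat_vec[of _ N N _ N]) auto
  finally show ?thesis .
qed

lemma conj_swap_supported: "supported c v \<Longrightarrow> supported c (conj_swap c' U *\<^sub>v v)"
proof -
  assume v: "supported c v"
  then have "supported c (lift (mat_adjoint U) *\<^sub>v (swap_gate c' *\<^sub>v (lift U *\<^sub>v v)))"
    using U_carrier by (intro lift_supported swap_supported adjoint_carrier)
  moreover have "v \<in> carrier_vec N"
    using v by (simp add: supported_def)
  ultimately show ?thesis
    using U_carrier by (simp add: conj_swap_mult_vec lift_adjoint)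
qed

text \<open>With the swap gate idle, the query meets its inverse. This takes the place of controlled
  queries.\<close>

lemma conj_swap_other_sector:
  assumes "supported c v" "c \<noteq> c'"
  shows "conj_swap c' U *\<^sub>v v = v"
proof -
  have v: "v \<in> carrier_vec N"
    using assms by (simp add: supported_def)
  have "swap_gate c' *\<^sub>v (lift U *\<^sub>v v) = lift U *\<^sub>v v"
    using assms U_carrier by (intro swap_other_sector lift_supported)
  then show ?thesis
    using v by (simp add: conj_swap_mult_vec unitary_adjoint_mult_vec[OF lift_unitary[OF U]])
qed

text \<open>The Born probabilities of a measurement of \<open>B\<close> are turned into amplitudes.\<close>

lemma conj_swap_amplitude:
  assumes v: "v \<in> carrier_vec (2 * m)" and c: "c < 2" and ik: "i < n" "k < K" "l < K"
  shows "(conj_swap c U *\<^sub>v place v c 0 l) \<bullet>c place v c i k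
    = (if k = l then of_real (\<Sum>x<2 * m. if x mod n = i then (cmod (((1\<^sub>m 2 \<otimes>\<^sub>m U) *\<^sub>v v) $ x))\<^sup>2 else 0) else 0)"
proof -
  define u where "u = (1\<^sub>m 2 \<otimes>\<^sub>m U) *\<^sub>v v"
  have u: "u \<in> carrier_vec (2 * m)"
    unfolding u_def using v U_carrier by (intro mult_mat_vec_carrier[of _ "2 * m" "2 * m"]) auto
  have L: "mat_adjoint (lift U) \<in> carrier_mat N N"
    by simp
  have C: "swap_gate c *\<^sub>v place u c 0 l \<in> carrier_vec N"
    using u by (intro mult_mat_vec_carrier[of _ N N]) auto
  have "(conj_swap c U *\<^sub>v place v c 0 l) \<bullet>c place v c i k
      = (mat_adjoint (lift U) *\<^sub>v (swap_gate c *\<^sub>v place u c 0 l)) \<bullet>c place v c i k"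
    using v U_carrier by (simp add: conj_swap_mult_vec lift_place u_def)
  \<comment> \<open>The inverse query moves to the right-hand argument, where it becomes the query
    again; both arguments then contain the same \<open>u\<close>.\<close>
  also have "\<dots> = (swap_gate c *\<^sub>v place u c 0 l) \<bullet>c (mat_adjoint (mat_adjoint (lift U)) *\<^sub>v place v c i k)"
    using v C by (intro cinner_adjoint[OF L]) auto
  also have "mat_adjoint (mat_adjoint (lift U)) *\<^sub>v place v c i k = place u c i k"
    using v U_carrier by (simp add: adjoint_adjoint[of _ N N] lift_place u_def)
  also have "(swap_gate c *\<^sub>v place u c 0 l) \<bullet>c place u c i k
      = (\<Sum>X<N. (swap_gate c *\<^sub>v place u c 0 l) $ X * cnj (place u c i k $ X))"
    using u by (simp add: cinner_sum carrier_vecD[OF place_carrier])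
  also have "\<dots> = (\<Sum>X<N. if X mod w = slot c i k
      then if k = l \<and> X div w mod n = i then of_real ((cmod (u $ (X div w)))\<^sup>2) else 0 else 0)"
  proof (intro sum.cong refl)
    fix X assume "X \<in> {..<N}"
    then have X: "X < N"
      by simp
    show "(swap_gate c *\<^sub>v place u c 0 l) $ X * cnj (place u c i k $ X) = (if X mod w = slot c i k
      then if k = l \<and> X div w mod n = i then of_real ((cmod (u $ (X div w)))\<^sup>2) else 0 else 0)"
    proof (cases "X mod w = slot c i k")
      case True
      then have sec: "sector X = c"
        using ik by (simp add: sector_def)
      \<comment> \<open>The gate reads its argument at the transposed copy value, which is 0 exactly
        if the \<open>B\<close>-value is \<open>i\<close>.\<close>
      let ?tr = "Transposition.transpose 0 (X div w mod n) i"
      have "swap_index c X mod w = slot c ?tr k"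
        using swap_index_parts(2)[OF sec] True ik by simp
      moreover have "slot c ?tr k = slot c 0 l \<longleftrightarrow> k = l \<and> X div w mod n = i"
        using n ik by (subst slot_inject) (auto simp: transpose_less, auto simp: transpose_def split: if_splits)
      ultimately have "place u c 0 l $ swap_index c X
          = (if k = l \<and> X div w mod n = i then u $ (X div w) else 0)"
        using u swap_index_less[OF X] by (simp add: place_index swap_index_div)
      then show ?thesis
        using X u True
        by (simp add: swap_gate_mult_vec place_index complex_norm_square[symmetric] del: index_mult_mat_vec)
    qed (use X u in \<open>simp add: place_index\<close>)
  qed
  also have "\<dots> = (\<Sum>x<2 * m. \<Sum>y<w. if y = slot c i k
      then if k = l \<and> x mod n = i then of_real ((cmod (u $ x))\<^sup>2) else 0 else 0)"
    by (rule sum_div_mod)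
  also have "\<dots> = (\<Sum>x<2 * m. if k = l \<and> x mod n = i then of_real ((cmod (u $ x))\<^sup>2) else 0)"
    using slot_less[OF c ik(1,2)] by simp
  also have "\<dots> = (if k = l then of_real (\<Sum>x<2 * m. if x mod n = i then (cmod (u $ x))\<^sup>2 else 0) else 0)"
    by (auto simp: if_distrib[of of_real] cong: if_cong)
  finally show ?thesis
    unfolding u_def .
qed

end

end

section \<open>The tester\<close>

context workspace
begin

lemma place_cinner:
  assumes "v \<in> carrier_vec (2 * m)" "l < n" "k < K" "l' < n" "k' < K" "c < 2" "c' < 2"
  shows "place v c l k \<bullet>c place v c' l' k' = (if c = c' \<and> l = l' \<and> k = k' then v \<bullet>c v else 0)"
proof -
  have "unit_vec w (slot c l k) \<bullet>c (unit_vec w (slot c' l' k') :: complex vec)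
      = (\<Sum>y<w. if y = slot c l k then (if slot c l k = slot c' l' k' then 1 else 0) else 0)"
    unfolding cinner_sum by (intro sum.cong) (auto simp: unit_vec_def)
  also have "\<dots> = (if c = c' \<and> l = l' \<and> k = k' then 1 else 0)"
    using assms by (simp add: slot_less slot_inject)
  finally show ?thesis
    unfolding place_def using assms by (subst cinner_tensor[of _ "2 * m" _ _ w]) auto
qed

definition walk_vec :: "complex vec \<Rightarrow> nat \<Rightarrow> complex vec" where
  "walk_vec r k = of_real (1 / sqrt 2) \<cdot>\<^sub>v (place r 0 0 k - place r 1 0 k)"

text \<open>The plus sign against the minus sign in \<open>walk_vec\<close> turns the two branches
  into a difference: sector 0 contributes with weight 1/2, sector 1 with weight -1/2.\<close>

definition good_vec :: "complex vec \<Rightarrow> nat \<times> nat \<Rightarrow> complex vec" where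
  "good_vec r = (\<lambda>(i, k). of_real (1 / sqrt 2) \<cdot>\<^sub>v (place r 0 i k + place r 1 i k))"

text \<open>The probability of outcome \<open>i\<close>, counted from 0, when \<open>B\<close> is
  measured after the oracle has acted on \<open>r\<close>.\<close>

definition born :: "complex vec \<Rightarrow> complex mat \<Rightarrow> nat \<Rightarrow> real" where
  "born r U i = (\<Sum>x<2 * m. if x mod n = i then (cmod (((1\<^sub>m 2 \<otimes>\<^sub>m U) *\<^sub>v r) $ x))\<^sup>2 else 0)"

lemma half:
  "complex_of_real (1 / sqrt 2) * (complex_of_real (1 / sqrt 2) * z) = z / 2"
  "complex_of_real (1 / sqrt 2) * (2 * complex_of_real (1 / sqrt 2)) = 1"
proof -
  have "complex_of_real (1 / sqrt 2) * complex_of_real (1 / sqrt 2) = complex_of_real (1 / 2)"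
    unfolding of_real_mult[symmetric] by simp
  then show "complex_of_real (1 / sqrt 2) * (complex_of_real (1 / sqrt 2) * z) = z / 2" for z
    by (simp add: mult.assoc[symmetric])
  from this[of 2] show "complex_of_real (1 / sqrt 2) * (2 * complex_of_real (1 / sqrt 2)) = 1"
    by (simp add: mult.commute)
qed

lemma cinner_half:
  assumes "u \<in> carrier_vec N" "v \<in> carrier_vec N" "x \<in> carrier_vec N" "y \<in> carrier_vec N"
  shows "(complex_of_real (1 / sqrt 2) \<cdot>\<^sub>v (u - v)) \<bullet>c (complex_of_real (1 / sqrt 2) \<cdot>\<^sub>v (x + y))
    = (u \<bullet>c x + u \<bullet>c y - (v \<bullet>c x + v \<bullet>c y)) / 2"
proof -
  have "(complex_of_real (1 / sqrt 2) \<cdot>\<^sub>v (u - v)) \<bullet>c (complex_of_real (1 / sqrt 2) \<cdot>\<^sub>v (x + y))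
      = complex_of_real (1 / sqrt 2) * (complex_of_real (1 / sqrt 2) * ((u - v) \<bullet>c (x + y)))"
    using assms by (simp add: cinner_smult_left[where N = N] cinner_smult_right[where N = N])
  then show ?thesis
    unfolding half using assms
    by (simp add: cinner_add_right[where N = N] cinner_minus_left[where N = N])
qed

text \<open>Sector 0 is affected by \<open>Up\<close> only and sector 1 by \<open>Uq\<close> only,
  at the price of two queries each.\<close>

definition difference_op :: "complex mat \<Rightarrow> complex mat \<Rightarrow> complex mat" where
  "difference_op Up Uq = conj_swap 1 Uq * conj_swap 0 Up"

context
  fixes r :: "complex vec"
  assumes r: "r \<in> carrier_vec (2 * m)" and r_norm: "r \<bullet>c r = 1"
begin

lemma walk_vec_carrier [simp]: "walk_vec r k \<in> carrier_vec N"
  using r by (simp add: walk_vec_def)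

lemma good_vec_carrier [simp]: "good_vec r ik \<in> carrier_vec N"
  using r by (cases ik) (simp add: good_vec_def)

lemma walk_vec_orthonormal: "orthonormal N {..<K} (walk_vec r)"
proof -
  have "walk_vec r k \<bullet>c walk_vec r l = (if k = l then 1 else 0)" if "k < K" "l < K" for k l
    using r n that unfolding walk_vec_def
    by (simp add: cinner_linear[where N = N] place_cinner r_norm half del: of_real_divide)
  then show ?thesis
    unfolding orthonormal_def by simp
qed

lemma good_vec_orthonormal: "orthonormal N ({..<n} \<times> J) (good_vec r)" if "J \<subseteq> {..<K}"
proof -
  have "good_vec r (i, k) \<bullet>c good_vec r (j, l) = (if i = j \<and> k = l then 1 else 0)"
    if "i < n" "j < n" "k < K" "l < K" for i j k l
    using r that unfolding good_vec_def prod.case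
    by (simp add: cinner_linear[where N = N] place_cinner r_norm half del: of_real_divide)
  then show ?thesis
    using that finite_subset[OF that] unfolding orthonormal_def by (auto simp: subset_iff)
qed

context
  fixes Up Uq :: "complex mat"
  assumes Up: "unitary_mat m Up" and Uq: "unitary_mat m Uq"
begin

text \<open>Each factor of \<open>difference_op\<close> fixes the other branch, and images stay in
  their sector. Hence the mixed inner products vanish, and the remaining two are Born
  probabilities.\<close>

lemma overlap:
  assumes i: "i < n" "k < K" "l < K"
  shows "(difference_op Up Uq *\<^sub>v walk_vec r l) \<bullet>c good_vec r (i, k)
    = (if k = l then of_real ((born r Up i - born r Uq i) / 2) else 0)"
proof -
  let ?P = "conj_swap 0 Up" and ?Q = "conj_swap 1 Uq"
  have P: "?P \<in> carrier_mat N N" and Q: "?Q \<in> carrier_mat N N"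
    using conj_swap_unitary[OF Up] conj_swap_unitary[OF Uq] by (auto intro: unitary_carrier)
  have B: "place r c j l' \<in> carrier_vec N" for c j l'
    using r by simp
  have s0: "supported 0 (?P *\<^sub>v place r 0 0 l)"
    using r n i by (intro conj_swap_supported[OF Up] place_supported) auto
  have s1: "supported 1 (?Q *\<^sub>v place r 1 0 l)"
    using r n i by (intro conj_swap_supported[OF Uq] place_supported) auto
  have c0: "?P *\<^sub>v place r 0 0 l \<in> carrier_vec N" and c1: "?Q *\<^sub>v place r 1 0 l \<in> carrier_vec N"
    using s0 s1 by (auto simp: supported_def)
  have "(?Q * ?P) *\<^sub>v walk_vec r l = ?Q *\<^sub>v (?P *\<^sub>v walk_vec r l)"
    using P Q by (intro assoc_mult_mat_vec[of _ N N _ N]) auto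
  also have "?P *\<^sub>v walk_vec r l
      = of_real (1 / sqrt 2) \<cdot>\<^sub>v (?P *\<^sub>v place r 0 0 l - ?P *\<^sub>v place r 1 0 l)"
    unfolding walk_vec_def using P B
    by (simp add: mult_mat_vec[of _ N N] mult_minus_distrib_mat_vec[of _ N N])
  also have "?P *\<^sub>v place r 1 0 l = place r 1 0 l"
    using r n i by (intro conj_swap_other_sector[OF Up, of 1] place_supported) auto
  also have "?Q *\<^sub>v (of_real (1 / sqrt 2) \<cdot>\<^sub>v (?P *\<^sub>v place r 0 0 l - place r 1 0 l))
      = of_real (1 / sqrt 2) \<cdot>\<^sub>v (?Q *\<^sub>v (?P *\<^sub>v place r 0 0 l) - ?Q *\<^sub>v place r 1 0 l)"
    using Q B c0 by (simp add: mult_mat_vec[of _ N N] mult_minus_distrib_mat_vec[of _ N N])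
  also have "?Q *\<^sub>v (?P *\<^sub>v place r 0 0 l) = ?P *\<^sub>v place r 0 0 l"
    by (rule conj_swap_other_sector[OF Uq s0]) simp
  finally have A: "(?Q * ?P) *\<^sub>v walk_vec r l
      = of_real (1 / sqrt 2) \<cdot>\<^sub>v (?P *\<^sub>v place r 0 0 l - ?Q *\<^sub>v place r 1 0 l)" .
  have "(?P *\<^sub>v place r 0 0 l) \<bullet>c place r 1 i k = 0"
    using r n i by (intro cinner_other_sector[OF s0, of 1] place_supported) auto
  moreover have "(?Q *\<^sub>v place r 1 0 l) \<bullet>c place r 0 i k = 0"
    using r n i by (intro cinner_other_sector[OF s1, of 0] place_supported) auto
  moreover have "(?P *\<^sub>v place r 0 0 l) \<bullet>c place r 0 i k = (if k = l then of_real (born r Up i) else 0)"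
    unfolding born_def by (rule conj_swap_amplitude[OF Up r]) (use i in auto)
  moreover have "(?Q *\<^sub>v place r 1 0 l) \<bullet>c place r 1 i k = (if k = l then of_real (born r Uq i) else 0)"
    unfolding born_def by (rule conj_swap_amplitude[OF Uq r]) (use i in auto)
  ultimately show ?thesis
    unfolding difference_op_def A good_vec_def prod.case cinner_half[OF c0 c1 B B] by simp
qed

lemma walks:
  "parallel_walks N K n (difference_op Up Uq) (walk_vec r) (good_vec r)
    (\<lambda>i. (born r Up i - born r Uq i) / 2)"
proof
  show "unitary_mat N (difference_op Up Uq)"
    unfolding difference_op_def by (intro unitary_mult conj_swap_unitary Up Uq)
qed (intro walk_vec_orthonormal good_vec_orthonormal overlap order_refl; assumption?)+

end

end

section \<open>The algorithm, its cost and its well-formedness\<close>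

definition conj_query :: "source \<Rightarrow> nat \<Rightarrow> query_alg \<Rightarrow> query_alg" where
  "conj_query s c T = Query s Forward Uncontrolled (Gate (swap_gate c) (Query s Inverse Uncontrolled T))"

text \<open>Calls are listed in order of application. Both factors of \<open>difference_op\<close>
  are self-adjoint, so its adjoint consists of the same two blocks in reverse order.\<close>

definition walk_round :: "complex vec \<Rightarrow> nat \<Rightarrow> query_alg \<Rightarrow> query_alg" where
  "walk_round r j T =
    conj_query Source_P 0 (conj_query Source_Q 1
      (Gate (reflection N ({..<n} \<times> {j<..<K}) (good_vec r))
        (conj_query Source_Q 1 (conj_query Source_P 0
          (Gate (reflection N {j<..<K} (walk_vec r)) T)))))"

definition decide :: "complex vec \<Rightarrow> query_alg" where
  "decide f = Measure [span_proj N {()} (\<lambda>_. f), 1\<^sub>m N - span_proj N {()} (\<lambda>_. f)]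
     (\<lambda>k. Output (if k = 0 then Equal else Far))"

text \<open>\<open>V\<close> is meant to prepare the start state of the walks from the initial
  state, as assumed in \<open>prob_tester\<close>.\<close>

definition tester :: "complex mat \<Rightarrow> complex vec \<Rightarrow> query_alg" where
  "tester V r = Gate V (foldr (walk_round r) [0..<K] (decide (walk_target N K (walk_vec r))))"

text \<open>A round has four conjugated queries of two calls each; preparation and measurement make
  none.\<close>

lemma query_count_tester: "query_count (tester V r) = 8 * K"
proof -
  have "query_count (foldr (walk_round r) js T) = 8 * length js + query_count T" for js T
    by (induction js) (simp_all add: walk_round_def conj_query_def)
  moreover have "query_count (decide f) = 0" for f
    by (simp add: decide_def image_constant_conv lessThan_Suc)
  ultimately show ?thesis
    by (simp add: tester_def)
qed

lemma well_formed_tester: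
  assumes r: "r \<in> carrier_vec (2 * m)" "r \<bullet>c r = 1" and V: "unitary_mat N V"
  shows "well_formed N (tester V r)"
proof -
  note S = walk_vec_orthonormal[OF r]
  have "well_formed N (foldr (walk_round r) js T)" if "well_formed N T" for js T
  proof (induction js)
    case (Cons j js)
    have "orthonormal N {j<..<K} (walk_vec r)"
      by (rule orthonormal_subset[OF S]) auto
    moreover have "orthonormal N ({..<n} \<times> {j<..<K}) (good_vec r)"
      by (rule good_vec_orthonormal[OF r]) auto
    ultimately show ?case
      using Cons by (simp add: walk_round_def conj_query_def swap_gate_unitary reflection_unitary)
  qed (use that in simp)
  moreover have "well_formed N (decide f)" if "f \<in> carrier_vec N" "f \<bullet>c f = 1" for f
  proof -
    let ?P = "span_proj N {()} (\<lambda>_. f)"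
    have P: "projector N ?P"
      using that by (intro span_proj_projector) (simp add: orthonormal_def)
    \<comment> \<open>The trailing zero matrix is the base case of the \<open>foldr\<close> in
      \<open>projective_measurement\<close>.\<close>
    have "?P + (1\<^sub>m N - ?P + 0\<^sub>m N N) = 1\<^sub>m N"
      by (rule eq_matI) auto
    then show ?thesis
      using P projector_compl[OF P] by (simp add: decide_def projective_measurement_def)
  qed
  ultimately show ?thesis
    using V walk_start_target_norm(2)[OF S K] by (simp add: tester_def)
qed

lemma prob_conj_query:
  assumes U: "unitary_mat m (chosen s Up Uq)" and v: "v \<in> carrier_vec N"
  shows "prob_output_from m w Up Uq d (conj_query s c T) v
    = prob_output_from m w Up Uq d T (conj_swap c (chosen s Up Uq) *\<^sub>v v)"
  using v by (simp add: conj_query_def query_op_def conj_swap_mult_vec[OF U]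
      lift_adjoint[OF unitary_carrier[OF U]] flip: lift_def)

section \<open>Outcome probabilities of the tester\<close>

context
  fixes r :: "complex vec" and Up Uq :: "complex mat"
  assumes r: "r \<in> carrier_vec (2 * m)" and r_norm: "r \<bullet>c r = 1"
    and Up: "unitary_mat m Up" and Uq: "unitary_mat m Uq"
begin

interpretation W: parallel_walks N K n "difference_op Up Uq" "walk_vec r" "good_vec r"
    "\<lambda>i. (born r Up i - born r Uq i) / 2"
  by (rule walks[OF r r_norm Up Uq])

lemma step_carrier: "v \<in> carrier_vec N \<Longrightarrow> W.step j v \<in> carrier_vec N"
  unfolding W.step_def by (intro mult_mat_vec_carrier[of _ N N]) auto

lemma step_norm:
  assumes v: "v \<in> carrier_vec N"
  shows "W.step j v \<bullet>c W.step j v = v \<bullet>c v"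
proof -
  have S: "unitary_mat N (reflection N {j<..<K} (walk_vec r))"
    by (rule reflection_unitary[OF orthonormal_subset[OF W.S]]) auto
  have G: "unitary_mat N (reflection N ({..<n} \<times> {j<..<K}) (good_vec r))"
    by (rule reflection_unitary[OF orthonormal_subset[OF W.G]]) auto
  note c = mult_mat_vec_carrier[of _ N N]
  show ?thesis
    unfolding W.step_def using v
    by (simp add: unitary_cinner[OF S] unitary_cinner[OF unitary_adjoint[OF W.A]] unitary_cinner[OF G]
        unitary_cinner[OF W.A] c)
qed

lemma prob_round:
  assumes v: "v \<in> carrier_vec N"
  shows "prob_output_from m w Up Uq d (walk_round r j T) v = prob_output_from m w Up Uq d T (W.step j v)"
proof -
  let ?P = "conj_swap 0 Up" and ?Q = "conj_swap 1 Uq"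
  have P: "unitary_mat N ?P" and Q: "unitary_mat N ?Q"
    by (intro conj_swap_unitary Up Uq)+
  note PQ = P[THEN unitary_carrier] Q[THEN unitary_carrier]
  have adj: "mat_adjoint (difference_op Up Uq) = ?P * ?Q"
    unfolding difference_op_def by (simp only: unitary_mult(2)[OF Q P] conj_swap_adjoint[OF Up] conj_swap_adjoint[OF Uq])
  note c = mult_mat_vec_carrier[of _ N N]
  have "W.step j v = reflection N {j<..<K} (walk_vec r) *\<^sub>v (?P *\<^sub>v (?Q *\<^sub>v
      (reflection N ({..<n} \<times> {j<..<K}) (good_vec r) *\<^sub>v (?Q *\<^sub>v (?P *\<^sub>v v)))))"
    \<comment> \<open>The adjoint is rewritten while \<open>difference_op\<close> is still folded,
      as \<open>adj\<close> is stated for it in that form.\<close>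
    unfolding W.step_def unfolding adj unfolding difference_op_def
    using v PQ by (simp add: c assoc_mult_mat_vec[of _ N N _ N])
  then show ?thesis
    using v PQ Up Uq by (simp add: walk_round_def prob_conj_query c)
qed

lemma prob_rounds:
  "v \<in> carrier_vec N \<Longrightarrow> prob_output_from m w Up Uq d (foldr (walk_round r) js T) v
    = prob_output_from m w Up Uq d T (fold W.step js v)"
  by (induction js arbitrary: v) (simp_all add: prob_round step_carrier)

text \<open>The projection of \<open>v\<close> onto the unit vector \<open>f\<close> is
  \<open>s\<close> times \<open>f\<close>; the other outcome gets the rest by Pythagoras.\<close>

lemma prob_decide:
  assumes f: "f \<in> carrier_vec N" "f \<bullet>c f = 1" and v: "v \<in> carrier_vec N" "v \<bullet>c v = 1"
    and s: "v \<bullet>c f = of_real s"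
  shows "prob_output_from m w Up Uq Equal (decide f) v = s\<^sup>2"
    and "prob_output_from m w Up Uq Far (decide f) v = 1 - s\<^sup>2"
proof -
  let ?P = "span_proj N {()} (\<lambda>_. f)"
  have P: "?P *\<^sub>v v = of_real s \<cdot>\<^sub>v f"
    using f v by (subst span_proj_mult_vec) (auto simp: comb_def s)
  have s': "f \<bullet>c v = of_real s"
    using cinner_cnj[OF v(1) f(1)] s by simp
  have "(1\<^sub>m N - ?P) *\<^sub>v v = 1\<^sub>m N *\<^sub>v v - ?P *\<^sub>v v"
    using v by (intro minus_mult_distrib_mat_vec) auto
  then have Q: "(1\<^sub>m N - ?P) *\<^sub>v v = v - of_real s \<cdot>\<^sub>v f"
    using v by (simp add: P)
  show "prob_output_from m w Up Uq Equal (decide f) v = s\<^sup>2"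
    using f v by (simp add: decide_def lessThan_Suc P cinner_linear[where N = N] power2_eq_square)
  show "prob_output_from m w Up Uq Far (decide f) v = 1 - s\<^sup>2"
    using f v by (simp add: decide_def lessThan_Suc Q s s' cinner_linear[where N = N] power2_eq_square)
qed

text \<open>The parameter \<open>t\<close> of the walks, under a name that outlives the local
  interpretation.\<close>

definition deviation :: real where
  "deviation = (\<Sum>i<n. ((born r Up i - born r Uq i) / 2)\<^sup>2)"

lemma prob_tester:
  assumes V: "unitary_mat N V" "V *\<^sub>v place r 0 0 0 = walk_start N K (walk_vec r)"
  defines "s \<equiv> (\<Sum>k<K. (- 1) ^ k * walk_amp deviation k) / K"
  shows "prob_output_from m w Up Uq Equal (tester V r) (place r 0 0 0) = s\<^sup>2"
    and "prob_output_from m w Up Uq Far (tester V r) (place r 0 0 0) = 1 - s\<^sup>2"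
proof -
  note norms = walk_start_target_norm[OF W.S K]
  let ?v = "fold W.step [0..<K] (walk_start N K (walk_vec r))"
  \<comment> \<open>Every round preserves the norm, so the final state is a unit vector, as the
    probability of \<open>Far\<close> requires.\<close>
  have fold: "fold W.step js u \<in> carrier_vec N \<and> fold W.step js u \<bullet>c fold W.step js u = u \<bullet>c u"
    if "u \<in> carrier_vec N" for js u
    using that by (induction js arbitrary: u) (simp_all add: step_carrier step_norm)
  have v: "?v \<in> carrier_vec N" "?v \<bullet>c ?v = 1"
    using fold[of "walk_start N K (walk_vec r)"] norms by simp_all
  have "?v \<bullet>c walk_target N K (walk_vec r) = of_real s"
    using W.final_amplitude by (simp only: s_def deviation_def W.t_def)
  note pd = prob_decide[OF _ norms(2) v this]
  show "prob_output_from m w Up Uq Equal (tester V r) (place r 0 0 0) = s\<^sup>2"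
    "prob_output_from m w Up Uq Far (tester V r) (place r 0 0 0) = 1 - s\<^sup>2"
    by (simp_all add: tester_def V prob_rounds pd)
qed

end

text \<open>The Householder reflection applies because the overlap is real: the two states share
  only the basis term with qubit, copy and counter 0, which gives
  \<open>1 / sqrt (2 K)\<close>.\<close>

lemma ex_preparation:
  assumes r: "r \<in> carrier_vec (2 * m)" "r \<bullet>c r = 1"
  shows "\<exists>V. unitary_mat N V \<and> V *\<^sub>v place r 0 0 0 = walk_start N K (walk_vec r)"
proof (rule ex_unitary_mapping)
  have p: "place r c l k \<in> carrier_vec N" for c l k
    using r by simp
  have "place r 0 0 0 \<bullet>c walk_vec r k = of_real (if k = 0 then 1 / sqrt 2 else 0)" if "k < K" for k
    using r n K p that unfolding walk_vec_def
    by (simp add: cinner_linear[where N = N] place_cinner)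
  then show "place r 0 0 0 \<bullet>c walk_start N K (walk_vec r)
      = of_real (\<Sum>k<K. 1 / sqrt K * (if k = 0 then 1 / sqrt 2 else 0))"
    unfolding walk_start_def of_real_sum of_real_mult using r p
    by (subst cinner_comb_right) (auto intro!: sum.cong)
  show "place r 0 0 0 \<bullet>c place r 0 0 0 = 1"
    using r n K by (simp add: place_cinner)
  show "walk_start N K (walk_vec r) \<bullet>c walk_start N K (walk_vec r) = 1"
    by (rule walk_start_target_norm[OF walk_vec_orthonormal[OF r] K])
qed (use r in auto)

end

section \<open>From the purified oracles to the distributions\<close>

text \<open>Entry \<open>y\<close> has \<open>B\<close>-value \<open>y mod n\<close>, and
  \<open>ket n i\<close> is the basis vector number \<open>i - 1\<close>; hence only
  \<open>i = Suc (y mod n)\<close> contributes.\<close>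

lemma purified_state_index:
  assumes carr: "\<And>i. i \<in> {1..n} \<Longrightarrow> \<phi> i \<in> carrier_vec a" and y: "y < a * n"
  shows "finsum_vec TYPE(complex) (a * n)
      (\<lambda>i. complex_of_real (sqrt (p i)) \<cdot>\<^sub>v (\<phi> i \<otimes>\<^sub>v ket n i)) {1..n} $ y
    = of_real (sqrt (p (Suc (y mod n)))) * \<phi> (Suc (y mod n)) $ (y div n)"
proof -
  have n: "n > 0"
    using y by (cases "n = 0") auto
  let ?i = "Suc (y mod n)"
  have i: "?i \<in> {1..n}"
    using n by (simp add: Suc_leI)
  have "finsum_vec TYPE(complex) (a * n)
      (\<lambda>i. complex_of_real (sqrt (p i)) \<cdot>\<^sub>v (\<phi> i \<otimes>\<^sub>v ket n i)) {1..n} $ y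
    = (\<Sum>i\<in>{1..n}. (complex_of_real (sqrt (p i)) \<cdot>\<^sub>v (\<phi> i \<otimes>\<^sub>v ket n i)) $ y)"
    using carr y by (intro index_finsum_vec) (auto simp: ket_def)
  also have "\<dots> = (\<Sum>i\<in>{1..n}. if i = ?i then of_real (sqrt (p ?i)) * \<phi> ?i $ (y div n) else 0)"
  proof (intro sum.cong refl)
    fix j assume j: "j \<in> {1..n}"
    then have "(j - 1 = y mod n) = (j = ?i)"
      by auto
    then show "(complex_of_real (sqrt (p j)) \<cdot>\<^sub>v (\<phi> j \<otimes>\<^sub>v ket n j)) $ y
        = (if j = ?i then of_real (sqrt (p ?i)) * \<phi> ?i $ (y div n) else 0)"
      using carr[OF j] j y n by (auto simp: tensor_vec_def ket_def unit_vec_def)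
  qed
  also have "\<dots> = of_real (sqrt (p ?i)) * \<phi> ?i $ (y div n)"
    using i by simp
  finally show ?thesis .
qed

text \<open>Summing over the \<open>A\<close>-index with the \<open>B\<close>-index fixed leaves
  \<open>p (Suc i)\<close> times the squared norm of the unit vector
  \<open>\<phi> (Suc i)\<close>.\<close>

lemma (in workspace) born_purified:
  assumes m: "m = a * n" and p: "distribution n p"
    and acc: "purified_access n a rA rB p U"
    and carr: "rA \<in> carrier_vec a" "rB \<in> carrier_vec n" and i: "i < n"
  shows "born (unit_vec 2 0 \<otimes>\<^sub>v (rA \<otimes>\<^sub>v rB)) U i = p (Suc i)"
proof -
  obtain \<phi> where \<phi>: "\<And>j. j \<in> {1..n} \<Longrightarrow> \<phi> j \<in> carrier_vec a"
    "\<And>j k. j \<in> {1..n} \<Longrightarrow> k \<in> {1..n} \<Longrightarrow> \<phi> j \<bullet>c \<phi> k = (if j = k then 1 else 0)"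
    "U *\<^sub>v (rA \<otimes>\<^sub>v rB) = finsum_vec TYPE(complex) (a * n)
      (\<lambda>j. complex_of_real (sqrt (p j)) \<cdot>\<^sub>v (\<phi> j \<otimes>\<^sub>v ket n j)) {1..n}"
    using acc unfolding purified_access_def by blast
  have U: "U \<in> carrier_mat m m"
    using acc unitary_carrier unfolding purified_access_def m by blast
  have AB: "rA \<otimes>\<^sub>v rB \<in> carrier_vec m"
    unfolding m using carr by simp
  define \<psi> where "\<psi> = U *\<^sub>v (rA \<otimes>\<^sub>v rB)"
  have \<psi>: "\<psi> \<in> carrier_vec m"
    unfolding \<psi>_def using U AB by simp
  have si: "Suc i \<in> {1..n}"
    using i by simp
  then have p_nonneg: "p (Suc i) \<ge> 0"
    using p unfolding distribution_def by blast
  have "born (unit_vec 2 0 \<otimes>\<^sub>v (rA \<otimes>\<^sub>v rB)) U i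
      = (\<Sum>x<2 * m. if x mod n = i then (cmod ((unit_vec 2 0 \<otimes>\<^sub>v \<psi>) $ x))\<^sup>2 else 0)"
  proof -
    have "(1\<^sub>m 2 \<otimes>\<^sub>m U) *\<^sub>v (unit_vec 2 0 \<otimes>\<^sub>v (rA \<otimes>\<^sub>v rB)) = (1\<^sub>m 2 *\<^sub>v unit_vec 2 0) \<otimes>\<^sub>v \<psi>"
      unfolding \<psi>_def by (rule tensor_mat_mult_vec[of _ 2 2 _ m m]) (use U AB in auto)
    then show ?thesis
      by (simp add: born_def cong: if_cong)
  qed
  \<comment> \<open>Since \<open>n\<close> divides \<open>m\<close>, removing the control qubit from
    the index does not affect the \<open>B\<close>-value.\<close>
  also have "\<dots> = (\<Sum>x<2 * m. if x mod m mod n = i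
      then (cmod (unit_vec 2 0 $ (x div m) * \<psi> $ (x mod m)))\<^sup>2 else 0)"
    using \<psi> by (intro sum.cong refl) (auto simp: tensor_vec_def m mod_mod_cancel)
  also have "\<dots> = (\<Sum>b<2. \<Sum>y<m. if y mod n = i then (cmod (unit_vec 2 0 $ b * \<psi> $ y))\<^sup>2 else 0)"
    by (rule sum_div_mod)
  also have "\<dots> = (\<Sum>y<m. if y mod n = i then (cmod (\<psi> $ y))\<^sup>2 else 0)"
    by (simp add: numeral_2_eq_2 lessThan_Suc cong: if_cong)
  also have "\<dots> = (\<Sum>y<a * n. if y mod n = i then p (Suc i) * (cmod (\<phi> (Suc i) $ (y div n)))\<^sup>2 else 0)"
    unfolding m
  proof (intro sum.cong refl)
    fix y assume "y \<in> {..<a * n}"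
    then have "\<psi> $ y = of_real (sqrt (p (Suc (y mod n)))) * \<phi> (Suc (y mod n)) $ (y div n)"
      unfolding \<psi>_def \<phi>(3) using \<phi>(1) by (intro purified_state_index) auto
    then show "(if y mod n = i then (cmod (\<psi> $ y))\<^sup>2 else 0)
        = (if y mod n = i then p (Suc i) * (cmod (\<phi> (Suc i) $ (y div n)))\<^sup>2 else 0)"
      using p_nonneg by (auto simp: norm_mult power_mult_distrib)
  qed
  also have "\<dots> = (\<Sum>x<a. \<Sum>j<n. if j = i then p (Suc i) * (cmod (\<phi> (Suc i) $ x))\<^sup>2 else 0)"
    by (rule sum_div_mod)
  also have "\<dots> = p (Suc i) * (\<Sum>x<a. (cmod (\<phi> (Suc i) $ x))\<^sup>2)"
    using i by (simp add: sum_distrib_left)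
  also have "(\<Sum>x<a. (cmod (\<phi> (Suc i) $ x))\<^sup>2) = 1"
  proof -
    have "complex_of_real (\<Sum>x<a. (cmod (\<phi> (Suc i) $ x))\<^sup>2) = 1"
      using \<phi>(2)[OF si si] unfolding cinner_self_real[OF \<phi>(1)[OF si]] if_P[OF refl] .
    then show ?thesis
      by (simp only: of_real_eq_1_iff)
  qed
  finally show ?thesis
    by simp
qed

section \<open>Numerical bounds and the choice of the number of iterations\<close>

text \<open>Each difference is at most 1 and at most \<open>p i + q i\<close> in absolute value. The
  bound keeps \<open>t\<close> below 1, which \<open>abs_sum_walk_amp_le\<close> demands.\<close>

lemma sum_sq_diff_le:
  assumes p: "distribution n p" and q: "distribution n q"
  shows "(\<Sum>i\<in>{1..n}. (p i - q i)\<^sup>2) \<le> 2"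
proof -
  have "(p i - q i)\<^sup>2 \<le> p i + q i" if i: "i \<in> {1..n}" for i
  proof -
    have le_1: "f i \<le> 1" if "distribution n f" for f
      using that i member_le_sum[of i "{1..n}" f] unfolding distribution_def by auto
    have nonneg: "0 \<le> p i" "0 \<le> q i"
      using p q i unfolding distribution_def by auto
    have "\<bar>p i - q i\<bar> * \<bar>p i - q i\<bar> \<le> 1 * (p i + q i)"
      using nonneg le_1[OF p] le_1[OF q] by (intro mult_mono) auto
    then show ?thesis
      by (simp add: power2_eq_square)
  qed
  then have "(\<Sum>i\<in>{1..n}. (p i - q i)\<^sup>2) \<le> (\<Sum>i\<in>{1..n}. p i + q i)"
    by (rule sum_mono)
  also have "\<dots> = 2"
    using p q by (simp add: sum.distrib distribution_def)
  finally show ?thesis .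
qed

text \<open>From \<open>sqrt t \<ge> \<epsilon> / 2\<close> follows \<open>1 + 1 / (2 sqrt t) \<le>
  1 + 1 / \<epsilon> \<le> 2 / \<epsilon> \<le> K / 2\<close>. The resulting error probability 1/4
  is below 1/3.\<close>

lemma walk_amp_average_le:
  assumes "0 < \<epsilon>" "\<epsilon> < 1" "\<epsilon>\<^sup>2 / 4 \<le> t" "t \<le> 1" "4 / \<epsilon> \<le> K"
  shows "((\<Sum>k<K. (- 1) ^ k * walk_amp t k) / real K)\<^sup>2 \<le> 1 / 4"
proof -
  have t: "t > 0"
    using assms by (smt (verit) zero_less_divide_iff zero_less_power)
  have K: "real K > 0"
    using assms by (smt (verit) divide_pos_pos)
  have "\<epsilon> / 2 \<le> sqrt t"
    using assms by (intro real_le_rsqrt) (simp add: power_divide)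
  then have "1 / (2 * sqrt t) \<le> 1 / \<epsilon>"
    using assms t by (intro divide_left_mono mult_pos_pos) auto
  then have "1 + 1 / (2 * sqrt t) \<le> 2 / \<epsilon>"
    using assms by (simp add: field_simps)
  then have "\<bar>\<Sum>k<K. (- 1) ^ k * walk_amp t k\<bar> \<le> K / 2"
    using abs_sum_walk_amp_le[OF t assms(4), of K] assms(5) by simp
  then have "\<bar>(\<Sum>k<K. (- 1) ^ k * walk_amp t k) / K\<bar> \<le> 1 / 2"
    using K by (simp add: field_simps)
  then have "((\<Sum>k<K. (- 1) ^ k * walk_amp t k) / real K)\<^sup>2 \<le> (1 / 2)\<^sup>2"
    by (intro abs_le_square_iff[THEN iffD1]) simp
  then show ?thesis
    by (simp add: power_divide)
qed

text \<open>The two signs \<open>(- 1)^k\<close> cancel, so every summand is 1; equality is thus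
  recognised with certainty.\<close>

lemma walk_amp_average_0:
  assumes "K > 0"
  shows "(\<Sum>k<K. (- 1) ^ k * walk_amp 0 k) / real K = 1"
proof -
  have "(- 1) ^ k * walk_amp 0 k = 1" for k
    by (simp add: walk_amp_def walk_coeff_0 flip: power_mult_distrib)
  then show ?thesis
    using assms by simp
qed

theorem corollary5:
  shows "\<exists>C > 0. \<forall>(n :: nat) (\<epsilon> :: real) (a :: nat) (rA :: complex vec) (rB :: complex vec).
    n \<ge> 1 \<and> 0 < \<epsilon> \<and> \<epsilon> < 1 \<and> unit_vector a rA \<and> unit_vector n rB \<longrightarrow>
    (\<exists>(w :: nat) (T :: query_alg).
       w \<ge> 1 \<and>
       well_formed (total_dim (a * n) w) T \<and>
       real (query_count T) \<le> C * (1 / \<epsilon>) \<and>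
       (\<forall>(p :: nat \<Rightarrow> real) (q :: nat \<Rightarrow> real) (Up :: complex mat) (Uq :: complex mat).
          distribution n p \<and> distribution n q \<and>
          purified_access n a rA rB p Up \<and> purified_access n a rA rB q Uq \<longrightarrow>
          ((\<forall>i \<in> {1..n}. p i = q i) \<longrightarrow> prob_output rA rB w Up Uq Equal T \<ge> 2 / 3) \<and>
          (L2_set (\<lambda>i. p i - q i) {1..n} \<ge> \<epsilon> \<longrightarrow> prob_output rA rB w Up Uq Far T \<ge> 2 / 3)))"
proof (intro exI[of _ "40 :: real"] conjI allI impI)
  fix n a :: nat and \<epsilon> :: real and rA rB :: "complex vec"
  assume asm: "n \<ge> 1 \<and> 0 < \<epsilon> \<and> \<epsilon> < 1 \<and> unit_vector a rA \<and> unit_vector n rB"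
  \<comment> \<open>The least number of iterations that \<open>walk_amp_average_le\<close>
    admits.\<close>
  define K where "K = nat \<lceil>4 / \<epsilon>\<rceil>"
  have "0 < 4 / \<epsilon>" and K_ge: "4 / \<epsilon> \<le> K" and "K \<le> 4 / \<epsilon> + 1"
    unfolding K_def using asm by (simp_all add: real_nat_ceiling_ge)
  moreover have "1 \<le> 1 / \<epsilon>" "4 / \<epsilon> = 4 * (1 / \<epsilon>)"
    using asm by simp_all
  \<comment> \<open>\<open>K \<le> 4 / \<epsilon> + 1 \<le> 5 / \<epsilon>\<close> rounds of 8
    queries each give the constant 40.\<close>
  ultimately have K_pos: "real K > 0" and K_le: "8 * real K \<le> 40 * (1 / \<epsilon>)"
    by linarith+
  define m where "m = a * n"
  interpret workspace m n K
    using asm K_pos by unfold_locales auto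
  define r where "r = unit_vec 2 0 \<otimes>\<^sub>v (rA \<otimes>\<^sub>v rB)"
  have ref: "rA \<in> carrier_vec a" "rB \<in> carrier_vec n" "rA \<bullet>c rA = 1" "rB \<bullet>c rB = 1"
    using asm by (auto simp: unit_vector_def)
  have AB: "rA \<otimes>\<^sub>v rB \<in> carrier_vec m"
    unfolding m_def using ref by simp
  have "unit_vec 2 0 \<bullet>c (unit_vec 2 0 :: complex vec) = 1"
    by (simp add: cinner_sum numeral_2_eq_2 lessThan_Suc)
  then have r: "r \<in> carrier_vec (2 * m)" "r \<bullet>c r = 1"
    unfolding r_def using AB ref
    by (simp_all add: cinner_tensor[of _ 2 _ _ m] cinner_tensor[of _ a _ _ n])
  obtain V where V: "unitary_mat (2 * m * w) V"
    "V *\<^sub>v place r 0 0 0 = walk_start (2 * m * w) K (walk_vec r)"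
    using ex_preparation[OF r] by blast
  have init: "initial_state rA rB w = place r 0 0 0"
    by (simp add: initial_state_def place_def r_def slot_def)
  have dim: "dim_vec rA * dim_vec rB = m"
    using ref by (simp add: m_def)
  show "\<exists>w T. w \<ge> 1 \<and> well_formed (total_dim (a * n) w) T \<and>
      real (query_count T) \<le> 40 * (1 / \<epsilon>) \<and>
      (\<forall>(p :: nat \<Rightarrow> real) (q :: nat \<Rightarrow> real) (Up :: complex mat) (Uq :: complex mat).
          distribution n p \<and> distribution n q \<and>
          purified_access n a rA rB p Up \<and> purified_access n a rA rB q Uq \<longrightarrow>
          ((\<forall>i \<in> {1..n}. p i = q i) \<longrightarrow> prob_output rA rB w Up Uq Equal T \<ge> 2 / 3) \<and>
          (L2_set (\<lambda>i. p i - q i) {1..n} \<ge> \<epsilon> \<longrightarrow> prob_output rA rB w Up Uq Far T \<ge> 2 / 3))"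
  proof (intro exI[of _ w] exI[of _ "tester V r"] conjI allI impI; (elim conjE)?)
    show "w \<ge> 1"
      using w_pos by simp
    show "well_formed (total_dim (a * n) w) (tester V r)"
      using well_formed_tester[OF r V(1)] by (simp add: total_dim_def m_def)
    show "real (query_count (tester V r)) \<le> 40 * (1 / \<epsilon>)"
      using K_le by (simp add: query_count_tester)
    fix p q :: "nat \<Rightarrow> real" and Up Uq :: "complex mat"
    assume pq: "distribution n p" "distribution n q"
      and acc: "purified_access n a rA rB p Up" "purified_access n a rA rB q Uq"
    have U: "unitary_mat m Up" "unitary_mat m Uq"
      using acc by (simp_all add: purified_access_def m_def)
    have born: "born r Up i = p (Suc i)" "born r Uq i = q (Suc i)" if "i < n" for i
      unfolding r_def using born_purified[OF m_def pq(1) acc(1) ref(1,2) that]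
        born_purified[OF m_def pq(2) acc(2) ref(1,2) that] by simp_all
    \<comment> \<open>\<open>born\<close> counts outcomes from 0, the distributions from 1; the
      factor 1/4 is the square of the 1/2 in the overlaps.\<close>
    have dev: "deviation r Up Uq = (\<Sum>i\<in>{1..n}. (p i - q i)\<^sup>2) / 4"
      unfolding deviation_def[OF r U]
      by (simp add: born sum_divide_distrib power_divide sum.atLeast1_atMost_eq)
    note prob = prob_tester[OF r U V, folded init]
    show "prob_output rA rB w Up Uq Equal (tester V r) \<ge> 2 / 3" if "\<forall>i \<in> {1..n}. p i = q i"
    proof -
      have "deviation r Up Uq = 0"
        using that by (simp add: dev)
      then show ?thesis
        unfolding prob_output_def dim prob using walk_amp_average_0[OF K] by simp
    qed
    show "prob_output rA rB w Up Uq Far (tester V r) \<ge> 2 / 3"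
      if far: "L2_set (\<lambda>i. p i - q i) {1..n} \<ge> \<epsilon>"
    proof -
      have "\<epsilon>\<^sup>2 \<le> (\<Sum>i\<in>{1..n}. (p i - q i)\<^sup>2)"
        using far asm unfolding L2_set_def by (intro sqrt_ge_absD) simp
      then have "((\<Sum>k<K. (- 1) ^ k * walk_amp (deviation r Up Uq) k) / real K)\<^sup>2 \<le> 1 / 4"
        using asm K_ge sum_sq_diff_le[OF pq] by (intro walk_amp_average_le[of \<epsilon>]) (simp_all add: dev)
      then show ?thesis
        unfolding prob_output_def dim prob by simp
    qed
  qed
qed simp

end
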